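(* Let $\varphi\in\mathcal{S}_2$ and let $\tau=(\tau^1,\tau^2)\in\mathbb{T}\times\mathbb{D}$ be a $B$-point for $\varphi$. Then (1) every point of $\{\tau^1\}\times\Delta$ is a $B$-point for $\varphi$; (2) every point of $\{\tau^1\}\times\mathbb{D}$ is a $C$-point for $\varphi$; (3) $\varphi$ is constant on $\{\tau^1\}\times\Delta$ (where $\varphi(\sigma)$ denotes the nontangential limit of $\varphi$ at the $B$-point $\sigma$); (4) the angular gradient $\nabla\varphi$ is constant on $\{\tau^1\}\times\mathbb{D}$, with value $$\nabla\varphi(\sigma)=\varphi(\tau)\,\overline{\tau^1}\,\alpha\begin{pmatrix}1\\0\end{pmatrix}\quad\text{for every }\sigma\in\{\tau^1\}\times\mathbb{D},$$ where $$\alpha=\liminf_{\lambda\to\tau}\frac{1-|\varphi(\lambda)|}{1-\|\lambda\|}.$$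
   Context: $\mathbb{D}$ is the open unit disk in $\mathbb{C}$, $\mathbb{T}$ the unit circle, $\Delta$ the closed unit disk. Superscripts on points of $\mathbb{C}^2$ are coordinate indices: $\lambda=(\lambda^1,\lambda^2)$, and $\|\lambda\|=\max\{|\lambda^1|,|\lambda^2|\}$. The Schur class $\mathcal{S}_2$ is the set of analytic functions $\varphi:\mathbb{D}^2\to\mathbb{C}$ with $|\varphi|\le 1$. A set $S\subset\Omega$ ($\Omega\subset\mathbb{C}^n$ a domain) approaches $\tau\in\partial\Omega$ nontangentially if $\tau$ lies in the closure of $S$ and $\|\lambda-\tau\|/\mathrm{dist}(\lambda,\mathbb{C}^n\setminus\Omega)$ is bounded for $\lambda\in S$. A nontangential limit at $\tau$ is a limit that exists, with the same value, along every set approaching $\tau$ nontangentially. A point $\tau\in\partial(\mathbb{D}^2)$ (topological boundary) is a $B$-point for $\varphi\in\mathcal{S}_2$ if $\liminf_{\lambda\to\tau}\frac{1-|\varphi(\lambda)|}{1-\|\lambda\|}<\infty$, where $\lambda$ ranges over $\mathbb{D}^2$. It is known that $\varphi$ has a nontangential limit of modulus $1$ at each $B$-point $\tau$; it is denoted $\varphi(\tau)$. A point $\tau\in\partial(\mathbb{D}^2)$ is a $C$-point for $\varphi$ if for every set $S\subset\mathbb{D}^2$ approaching $\tau$ nontangentially there are $\omega,\eta^1,\eta^2\in\mathbb{C}$ with $|\omega|=1$ such that $\varphi(\lambda)=\omega+\eta^1(\lambda^1-\tau^1)+\eta^2(\lambda^2-\tau^2)+e(\lambda)$ for $\lambda\in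 S$, where $e(\lambda)/\|\lambda-\tau\|\to0$ as $\lambda\to\tau$ in $S$. The quantities $\omega,\eta^1,\eta^2$ are then the same for every such nontangential approach region, and the angular gradient is $\nabla\varphi(\tau)=\begin{pmatrix}\eta^1\\\eta^2\end{pmatrix}$. *)

theory Defs
  imports "HOL-Analysis.Analysis"
begin

text \<open>Points of \<open>\<complex>\<^sup>2\<close> are pairs. The library norm on pairs is the Euclidean one; it induces
  the same topology as the maximum norm, so library filters and frontiers can be used, but
  all quantitative notions below use the maximum norm.\<close>

definition maxnorm :: "complex \<times> complex \<Rightarrow> real" where
  "maxnorm z = max (cmod (fst z)) (cmod (snd z))"

definition bidisk :: "(complex \<times> complex) set" where
  "bidisk = ball 0 1 \<times> ball 0 1"

text \<open>Analyticity in two variables: \<open>\<phi>\<close> has a complex-linear Frechet derivative at every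
  point of the open set.\<close>

definition holomorphic2_on :: "(complex \<times> complex \<Rightarrow> complex) \<Rightarrow> (complex \<times> complex) set \<Rightarrow> bool" where
  "holomorphic2_on \<phi> U \<longleftrightarrow>
     (\<forall>z\<in>U. \<exists>a b. (\<phi> has_derivative (\<lambda>h. a * fst h + b * snd h)) (at z))"

text \<open>Functions are total in HOL; the values of \<open>\<phi>\<close> off the bidisk are irrelevant throughout.\<close>

definition schur2 :: "(complex \<times> complex \<Rightarrow> complex) set" where
  "schur2 = {\<phi>. holomorphic2_on \<phi> bidisk \<and> (\<forall>z\<in>bidisk. cmod (\<phi> z) \<le> 1)}"

definition maxdist :: "complex \<times> complex \<Rightarrow> (complex \<times> complex) set \<Rightarrow> real" where
  "maxdist z A = (INF w\<in>A. maxnorm (z - w))"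

definition approaches_nt :: "(complex \<times> complex) set \<Rightarrow> (complex \<times> complex) set \<Rightarrow> complex \<times> complex \<Rightarrow> bool" where
  "approaches_nt \<Omega> S \<tau> \<longleftrightarrow>
     S \<subseteq> \<Omega> \<and> \<tau> \<in> frontier \<Omega> \<and> \<tau> \<in> closure S \<and>
     (\<exists>c. \<forall>z\<in>S. maxnorm (z - \<tau>) / maxdist z (- \<Omega>) \<le> c)"

definition has_nt_limit :: "(complex \<times> complex \<Rightarrow> complex) \<Rightarrow> complex \<times> complex \<Rightarrow> complex \<Rightarrow> bool" where
  "has_nt_limit \<phi> \<tau> L \<longleftrightarrow>
     (\<forall>S. approaches_nt bidisk S \<tau> \<longrightarrow> (\<phi> \<longlongrightarrow> L) (at \<tau> within S))"

definition nt_value :: "(complex \<times> complex \<Rightarrow> complex) \<Rightarrow> complex \<times> complex \<Rightarrow> complex" where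
  "nt_value \<phi> \<tau> = (THE L. has_nt_limit \<phi> \<tau> L)"

definition julia_liminf :: "(complex \<times> complex \<Rightarrow> complex) \<Rightarrow> complex \<times> complex \<Rightarrow> ereal" where
  "julia_liminf \<phi> \<tau> =
     Liminf (at \<tau> within bidisk) (\<lambda>z. ereal ((1 - cmod (\<phi> z)) / (1 - maxnorm z)))"

definition B_point :: "(complex \<times> complex \<Rightarrow> complex) \<Rightarrow> complex \<times> complex \<Rightarrow> bool" where
  "B_point \<phi> \<tau> \<longleftrightarrow> \<tau> \<in> frontier bidisk \<and> julia_liminf \<phi> \<tau> < \<infinity>"

text \<open>First-order expansion \<open>\<phi>(z) = \<omega> + \<eta>\<^sup>1 (z\<^sup>1 - \<tau>\<^sup>1) + \<eta>\<^sup>2 (z\<^sup>2 - \<tau>\<^sup>2) + o(\<parallel>z - \<tau>\<parallel>)\<close>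
  along \<open>S\<close>, where \<open>\<eta>\<close> is the pair \<open>(\<eta>\<^sup>1, \<eta>\<^sup>2)\<close>.\<close>

definition expands_along ::
  "(complex \<times> complex \<Rightarrow> complex) \<Rightarrow> complex \<times> complex \<Rightarrow> (complex \<times> complex) set \<Rightarrow>
   complex \<Rightarrow> complex \<times> complex \<Rightarrow> bool" where
  "expands_along \<phi> \<tau> S \<omega> \<eta> \<longleftrightarrow>
     ((\<lambda>z. (\<phi> z - (\<omega> + fst \<eta> * (fst z - fst \<tau>) + snd \<eta> * (snd z - snd \<tau>)))
            / complex_of_real (maxnorm (z - \<tau>))) \<longlongrightarrow> 0) (at \<tau> within S)"

definition C_point :: "(complex \<times> complex \<Rightarrow> complex) \<Rightarrow> complex \<times> complex \<Rightarrow> bool" where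
  "C_point \<phi> \<tau> \<longleftrightarrow> \<tau> \<in> frontier bidisk \<and>
     (\<forall>S. approaches_nt bidisk S \<tau> \<longrightarrow>
        (\<exists>\<omega> \<eta>. cmod \<omega> = 1 \<and> expands_along \<phi> \<tau> S \<omega> \<eta>))"

text \<open>A thin set \<open>S\<close> (a single sequence, say) need not determine \<open>\<eta>\<close>, so the gradient is the
  pair that serves all nontangential sets simultaneously.\<close>

definition has_angular_gradient ::
  "(complex \<times> complex \<Rightarrow> complex) \<Rightarrow> complex \<times> complex \<Rightarrow> complex \<times> complex \<Rightarrow> bool" where
  "has_angular_gradient \<phi> \<tau> \<eta> \<longleftrightarrow>
     (\<exists>\<omega>. cmod \<omega> = 1 \<and> (\<forall>S. approaches_nt bidisk S \<tau> \<longrightarrow> expands_along \<phi> \<tau> S \<omega> \<eta>))"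

definition angular_gradient ::
  "(complex \<times> complex \<Rightarrow> complex) \<Rightarrow> complex \<times> complex \<Rightarrow> complex \<times> complex" where
  "angular_gradient \<phi> \<tau> = (THE \<eta>. has_angular_gradient \<phi> \<tau> \<eta>)"

end

theory Submission
  imports Defs "HOL-Complex_Analysis.Complex_Analysis"
begin

text \<open>
  Write \<open>t = fst \<tau>\<close>. Everything rests on one inequality. Let points of the bidisk tend to
  \<open>\<tau>\<close> so as to realise the lower limit \<open>\<alpha>\<close>, and pass to a subsequence along which \<open>\<phi>\<close>
  tends to some \<open>\<omega>\<close>, necessarily of modulus one. In the Schwarz--Pick inequality of the
  bidisk the larger of the two coordinate distances counts. As \<open>fst \<tau>\<close> lies on the circle
  and \<open>snd \<tau>\<close> does not, from some index on this is the distance in the first coordinate,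
  and in the limit the second coordinate disappears (\<open>julia_inequality\<close>):
  \<open>|\<omega> - \<phi> z|\<^sup>2 (1 - |z\<^sup>1|\<^sup>2) \<le> \<alpha> |t - z\<^sup>1|\<^sup>2 (1 - |\<phi> z|\<^sup>2)\<close> for all \<open>z\<close> in the bidisk.
  Being blind to \<open>snd \<tau>\<close>, the inequality treats all points \<open>\<sigma>\<close> of the closed disk
  \<open>{t} \<times> \<Delta>\<close> alike: on the radius to \<open>\<sigma>\<close> it bounds the Julia quotient, so \<open>\<sigma>\<close> is a
  \<open>B\<close>-point, and on a nontangential set it forces \<open>\<phi> \<longlongrightarrow> \<omega>\<close>.

  If \<open>\<phi>\<close> takes the value \<open>\<omega>\<close> in the bidisk, it is constant, \<open>\<alpha> = 0\<close>, and the claim on the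
  gradient is clear. Otherwise \<open>\<alpha> > 0\<close>, and the same inequality says that
  \<open>F z = (\<omega> + \<phi> z) / (\<omega> - \<phi> z) - (t + z\<^sup>1) / (\<alpha> (t - z\<^sup>1))\<close> has nonnegative real part.
  That \<open>\<alpha>\<close> is a lower limit gives a converse estimate on the radius to \<open>\<tau>\<close>; the two
  together determine the radial derivative there
  (\<open>radial_derivative\<close>), which means \<open>(t - z\<^sup>1) F \<longlonglongrightarrow> 0\<close> along that radius. Harnack's
  inequality on the bidisk compares \<open>F\<close> at a point near \<open>\<sigma> \<in> {t} \<times> ball 0 1\<close> with \<open>F\<close> at the
  point of the radius to \<open>\<tau>\<close> that is equally far from \<open>t\<close> in the first coordinate. On a
  nontangential set their pseudohyperbolic distance stays below a constant less than one, so
  \<open>(t - z\<^sup>1) F \<longlonglongrightarrow> 0\<close> holds there too (\<open>harnack_nontangential\<close>). Solving for \<open>\<phi>\<close> yields the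
  expansion with gradient \<open>(\<omega> cnj t \<alpha>, 0)\<close>, the same for every \<open>\<sigma>\<close>.
\<close>

section \<open>Schwarz--Pick and Harnack on the bidisk\<close>

text \<open>Analyticity tested on analytic discs. It is all that Schwarz--Pick needs, and its
  closure under algebraic operations is inherited from one variable.\<close>

definition disc_holomorphic :: "(complex \<times> complex \<Rightarrow> complex) \<Rightarrow> bool" where
  "disc_holomorphic f \<longleftrightarrow>
     (\<forall>u v. u holomorphic_on ball 0 1 \<and> v holomorphic_on ball 0 1 \<and>
            (\<forall>\<zeta>\<in>ball 0 1. (u \<zeta>, v \<zeta>) \<in> bidisk) \<longrightarrow>
            (\<lambda>\<zeta>. f (u \<zeta>, v \<zeta>)) holomorphic_on ball 0 1)"

lemma mem_bidisk: "z \<in> bidisk \<longleftrightarrow> cmod (fst z) < 1 \<and> cmod (snd z) < 1"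
  by (cases z) (simp add: bidisk_def)

lemma disc_holomorphicI:
  assumes "holomorphic2_on \<phi> bidisk"
  shows "disc_holomorphic \<phi>"
  unfolding disc_holomorphic_def
proof (intro allI impI, elim conjE)
  fix u v :: "complex \<Rightarrow> complex"
  assume u: "u holomorphic_on ball 0 1" and v: "v holomorphic_on ball 0 1"
    and uv: "\<forall>\<zeta>\<in>ball 0 1. (u \<zeta>, v \<zeta>) \<in> bidisk"
  have "(\<lambda>\<zeta>. \<phi> (u \<zeta>, v \<zeta>)) field_differentiable at \<zeta>" if \<zeta>: "\<zeta> \<in> ball 0 1" for \<zeta>
  proof -
    obtain u' v' where u': "(u has_field_derivative u') (at \<zeta>)"
      and v': "(v has_field_derivative v') (at \<zeta>)"
      using u v \<zeta> by (metis holomorphic_on_imp_differentiable_at open_ball field_differentiable_def)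
    obtain a b where ab: "(\<phi> has_derivative (\<lambda>h. a * fst h + b * snd h)) (at (u \<zeta>, v \<zeta>))"
      using assms uv \<zeta> unfolding holomorphic2_on_def by blast
    have "((\<lambda>\<zeta>. (u \<zeta>, v \<zeta>)) has_derivative (\<lambda>h. (u' * h, v' * h))) (at \<zeta>)"
      using u' v' by (intro has_derivative_Pair) (simp_all add: has_field_derivative_def)
    from has_derivative_compose[OF this ab]
    have "((\<lambda>\<zeta>. \<phi> (u \<zeta>, v \<zeta>)) has_derivative (\<lambda>h. a * (u' * h) + b * (v' * h))) (at \<zeta>)"
      by simp
    moreover have "(\<lambda>h. a * (u' * h) + b * (v' * h)) = (*) (a * u' + b * v')"
      by (simp add: fun_eq_iff algebra_simps)
    ultimately have "((\<lambda>\<zeta>. \<phi> (u \<zeta>, v \<zeta>)) has_field_derivative (a * u' + b * v')) (at \<zeta>)"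
      by (simp add: has_field_derivative_def)
    then show ?thesis
      by (auto simp: field_differentiable_def)
  qed
  then show "(\<lambda>\<zeta>. \<phi> (u \<zeta>, v \<zeta>)) holomorphic_on ball 0 1"
    by (simp add: holomorphic_on_def field_differentiable_at_within)
qed

text \<open>The left-hand side, divided by the first square, is one minus the square of the
  pseudohyperbolic distance \<open>|a - b| / |1 - cnj b a|\<close>. Distances are kept in this multiplied-out
  form because the denominator vanishes when \<open>a\<close> and \<open>b\<close> are the same unimodular number.\<close>

lemma pseudohyperbolic_identity:
  "(cmod (1 - cnj b * a))\<^sup>2 - (cmod (a - b))\<^sup>2 = (1 - (cmod a)\<^sup>2) * (1 - (cmod b)\<^sup>2)"
  by (simp add: cmod_power2) algebra

lemma one_minus_cnj_mult_neq_0: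
  assumes "cmod a \<le> 1" "cmod b < 1"
  shows "1 - cnj b * a \<noteq> 0"
proof
  assume "1 - cnj b * a = 0"
  then have "cmod (cnj b * a) = 1" by simp
  moreover have "cmod (cnj b * a) \<le> cmod b * 1"
    unfolding norm_mult complex_mod_cnj using assms by (intro mult_left_mono) auto
  ultimately show False using assms by simp
qed

lemma pseudohyperbolic_lt_1:
  assumes "cmod a < 1" "cmod b < 1"
  shows "cmod (a - b) < cmod (1 - cnj b * a)"
proof -
  have "(1 - (cmod a)\<^sup>2) * (1 - (cmod b)\<^sup>2) > 0"
    using assms by (intro mult_pos_pos) (simp_all add: power_less_one_iff)
  then have "(cmod (a - b))\<^sup>2 < (cmod (1 - cnj b * a))\<^sup>2"
    using pseudohyperbolic_identity[of b a] by linarith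
  then show ?thesis
    using power_less_imp_less_base by fastforce
qed

text \<open>Schwarz's lemma applied to \<open>f\<close> followed by the disk automorphism that moves \<open>f 0\<close> to \<open>0\<close>.\<close>

lemma schwarz_pick_disc_strict:
  assumes f: "f holomorphic_on ball 0 1" and "\<And>z. cmod z < 1 \<Longrightarrow> cmod (f z) < 1" and "cmod \<zeta> < 1"
  shows "cmod (f \<zeta> - f 0) \<le> cmod \<zeta> * cmod (1 - cnj (f 0) * f \<zeta>)"
proof -
  define h where "h z = (f z - f 0) / (1 - cnj (f 0) * f z)" for z
  have nz: "1 - cnj (f 0) * f z \<noteq> 0" if "cmod z < 1" for z
    using one_minus_cnj_mult_neq_0[of "f z" "f 0"] assms(2)[of z] assms(2)[of 0] that by simp
  have "h holomorphic_on ball 0 1"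
    unfolding h_def using nz by (intro holomorphic_intros f) auto
  moreover have "cmod (h z) < 1" if "cmod z < 1" for z
    using pseudohyperbolic_lt_1[OF assms(2)[OF that] assms(2)[of 0]] nz[OF that]
    by (simp add: h_def norm_divide divide_simps)
  moreover have "h 0 = 0"
    by (simp add: h_def)
  ultimately have "cmod (h \<zeta>) \<le> cmod \<zeta>"
    using assms(3) by (intro Schwarz_Lemma(1)) auto
  then show ?thesis
    using nz[OF assms(3)] by (simp add: h_def norm_divide divide_simps)
qed

text \<open>Unimodular values are admitted by applying the strict case to \<open>c f\<close> and letting \<open>c\<close>
  increase to \<open>1\<close>.\<close>

lemma schwarz_pick_disc:
  assumes f: "f holomorphic_on ball 0 1" and b: "\<And>z. cmod z < 1 \<Longrightarrow> cmod (f z) \<le> 1" and "cmod \<zeta> < 1"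
  shows "cmod (f \<zeta> - f 0) \<le> cmod \<zeta> * cmod (1 - cnj (f 0) * f \<zeta>)"
proof -
  have *: "cmod (of_real c * f \<zeta> - of_real c * f 0)
            \<le> cmod \<zeta> * cmod (1 - cnj (of_real c * f 0) * (of_real c * f \<zeta>))"
    if c: "0 < c" "c < 1" for c :: real
  proof (rule schwarz_pick_disc_strict[where f = "\<lambda>z. of_real c * f z", OF _ _ assms(3)])
    show "(\<lambda>z. of_real c * f z) holomorphic_on ball 0 1"
      by (intro holomorphic_intros f)
    show "cmod (of_real c * f z) < 1" if "cmod z < 1" for z
    proof -
      have "c * cmod (f z) \<le> c * 1"
        using b[OF that] c by (intro mult_left_mono) auto
      also have "\<dots> < 1" using c by simp
      finally show ?thesis
        using c by (simp add: norm_mult)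
    qed
  qed
  show ?thesis
  proof (rule tendsto_le[of "at_left (1::real)"])
    show "((\<lambda>c. cmod (of_real c * f \<zeta> - of_real c * f 0)) \<longlongrightarrow> cmod (f \<zeta> - f 0)) (at_left 1)"
      by (auto intro!: tendsto_eq_intros)
    show "((\<lambda>c. cmod \<zeta> * cmod (1 - cnj (of_real c * f 0) * (of_real c * f \<zeta>)))
            \<longlongrightarrow> cmod \<zeta> * cmod (1 - cnj (f 0) * f \<zeta>)) (at_left 1)"
      by (auto intro!: tendsto_eq_intros)
    have "eventually (\<lambda>c::real. 0 < c \<and> c < 1) (at_left 1)"
      using eventually_at_left_field[of _ "1::real"] by (auto intro!: exI[of _ 0])
    then show "\<forall>\<^sub>F c in at_left 1. cmod (of_real c * f \<zeta> - of_real c * f 0)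
            \<le> cmod \<zeta> * cmod (1 - cnj (of_real c * f 0) * (of_real c * f \<zeta>))"
      by eventually_elim (use * in auto)
  qed simp
qed

text \<open>A disk automorphism after a contraction: the factor \<open>s\<close> shrinks the disk just enough
  for \<open>a\<close> to be reached at the parameter \<open>k\<close>. In two coordinates the same \<open>k\<close> can then serve
  for both, although the distances differ.\<close>

lemma disc_through_two_points:
  assumes "cmod a < 1" "cmod b < 1" "0 < k" "k < 1" "cmod (a - b) \<le> k * cmod (1 - cnj b * a)"
  obtains u where "u holomorphic_on ball 0 1" "\<And>\<zeta>. cmod \<zeta> < 1 \<Longrightarrow> cmod (u \<zeta>) < 1"
    "u 0 = b" "u (of_real k) = a"
proof -
  define s where "s = (a - b) / (1 - cnj b * a) / of_real k"
  define u where "u \<zeta> = (s * \<zeta> + b) / (1 + cnj b * (s * \<zeta>))" for \<zeta>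
  have nz0: "1 - cnj b * a \<noteq> 0"
    using assms by (intro one_minus_cnj_mult_neq_0) auto
  have s: "cmod s \<le> 1"
    using assms nz0 by (simp add: s_def norm_divide norm_mult divide_simps mult.commute)
  have s\<zeta>: "cmod (s * \<zeta>) < 1" if "cmod \<zeta> < 1" for \<zeta>
    using mult_right_mono[OF s, of "cmod \<zeta>"] that by (simp add: norm_mult)
  have nz: "1 + cnj b * (s * \<zeta>) \<noteq> 0" if "cmod \<zeta> < 1" for \<zeta>
    using one_minus_cnj_mult_neq_0[of "s * \<zeta>" "- b"] s\<zeta>[OF that] assms by simp
  show thesis
  proof
    show "u holomorphic_on ball 0 1"
      unfolding u_def using nz by (intro holomorphic_intros) auto
    show "cmod (u \<zeta>) < 1" if "cmod \<zeta> < 1" for \<zeta>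
      using pseudohyperbolic_lt_1[OF s\<zeta>[OF that], of "- b"] assms nz[OF that]
      by (simp add: u_def norm_divide divide_simps)
    show "u 0 = b" by (simp add: u_def)
    define D where "D = 1 - cnj b * a"
    have sk: "s * of_real k = (a - b) / D"
      using assms by (simp add: s_def D_def)
    have D: "D \<noteq> 0" using nz0 by (simp add: D_def)
    have bb: "1 - cnj b * b \<noteq> 0"
      using assms by (intro one_minus_cnj_mult_neq_0) auto
    have num: "(a - b) / D + b = a * (1 - cnj b * b) / D"
      using D by (simp add: field_simps) (simp add: D_def algebra_simps)
    have den: "1 + cnj b * ((a - b) / D) = (1 - cnj b * b) / D"
      using D by (simp add: field_simps) (simp add: D_def algebra_simps)
    show "u (of_real k) = a"
      unfolding u_def sk num den using D bb by simp
  qed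
qed

text \<open>The disc \<open>\<zeta> \<mapsto> (u \<zeta>, v \<zeta>)\<close> through \<open>w\<close> (at \<open>0\<close>) and \<open>z\<close> (at \<open>k\<close>) reduces the claim to
  one variable.\<close>

lemma schwarz_pick_bidisk:
  assumes f: "disc_holomorphic f" and b: "\<And>z. z \<in> bidisk \<Longrightarrow> cmod (f z) \<le> 1"
    and z: "z \<in> bidisk" and w: "w \<in> bidisk" and k: "0 < k" "k < 1"
    and "cmod (fst z - fst w) \<le> k * cmod (1 - cnj (fst w) * fst z)"
    and "cmod (snd z - snd w) \<le> k * cmod (1 - cnj (snd w) * snd z)"
  shows "cmod (f z - f w) \<le> k * cmod (1 - cnj (f w) * f z)"
proof -
  obtain u where u: "u holomorphic_on ball 0 1" "\<And>\<zeta>. cmod \<zeta> < 1 \<Longrightarrow> cmod (u \<zeta>) < 1"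
    "u 0 = fst w" "u (of_real k) = fst z"
    using disc_through_two_points[of "fst z" "fst w" k] assms mem_bidisk by metis
  obtain v where v: "v holomorphic_on ball 0 1" "\<And>\<zeta>. cmod \<zeta> < 1 \<Longrightarrow> cmod (v \<zeta>) < 1"
    "v 0 = snd w" "v (of_real k) = snd z"
    using disc_through_two_points[of "snd z" "snd w" k] assms mem_bidisk by metis
  have "(\<lambda>\<zeta>. f (u \<zeta>, v \<zeta>)) holomorphic_on ball 0 1"
    using f u v by (auto simp: disc_holomorphic_def mem_bidisk)
  moreover have "cmod (f (u \<zeta>, v \<zeta>)) \<le> 1" if "cmod \<zeta> < 1" for \<zeta>
    using that u(2) v(2) by (intro b) (auto simp: mem_bidisk)
  ultimately have "cmod (f (u (of_real k), v (of_real k)) - f (u 0, v 0))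
      \<le> cmod (of_real k) * cmod (1 - cnj (f (u 0, v 0)) * f (u (of_real k), v (of_real k)))"
    using k by (intro schwarz_pick_disc) auto
  then show ?thesis
    using k by (simp add: u v)
qed

text \<open>The Cayley transform of \<open>F\<close> is bounded by one, and Schwarz--Pick for it reads
  \<open>|F z - F w| \<le> k |F z + cnj (F w)|\<close>.\<close>

lemma harnack_bidisk:
  assumes F: "disc_holomorphic F" and pos: "\<And>z. z \<in> bidisk \<Longrightarrow> 0 \<le> Re (F z)"
    and z: "z \<in> bidisk" and w: "w \<in> bidisk" and k: "0 < k" "k < 1"
    and "cmod (fst z - fst w) \<le> k * cmod (1 - cnj (fst w) * fst z)"
    and "cmod (snd z - snd w) \<le> k * cmod (1 - cnj (snd w) * snd z)"
  shows "cmod (F z) \<le> (1 + k) / (1 - k) * cmod (F w)"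
proof -
  define f where "f z = (F z - 1) / (F z + 1)" for z
  have nz: "F z + 1 \<noteq> 0" if "z \<in> bidisk" for z
    using pos[OF that] by (auto simp: complex_eq_iff)
  have hol: "disc_holomorphic f"
    unfolding disc_holomorphic_def f_def
  proof (intro allI impI, elim conjE)
    fix u v :: "complex \<Rightarrow> complex"
    assume uv: "u holomorphic_on ball 0 1" "v holomorphic_on ball 0 1"
      "\<forall>\<zeta>\<in>ball 0 1. (u \<zeta>, v \<zeta>) \<in> bidisk"
    then have "(\<lambda>\<zeta>. F (u \<zeta>, v \<zeta>)) holomorphic_on ball 0 1"
      using F by (simp add: disc_holomorphic_def)
    moreover have "F (u \<zeta>, v \<zeta>) + 1 \<noteq> 0" if "\<zeta> \<in> ball 0 1" for \<zeta>
      using that uv by (intro nz) auto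
    ultimately show "(\<lambda>\<zeta>. (F (u \<zeta>, v \<zeta>) - 1) / (F (u \<zeta>, v \<zeta>) + 1)) holomorphic_on ball 0 1"
      by (intro holomorphic_intros) auto
  qed
  have bd: "cmod (f z) \<le> 1" if "z \<in> bidisk" for z
  proof -
    have "(cmod (F z - 1))\<^sup>2 \<le> (cmod (F z + 1))\<^sup>2"
      using pos[OF that] unfolding cmod_power2 by (simp add: power2_eq_square algebra_simps)
    then have "cmod (F z - 1) \<le> cmod (F z + 1)"
      by (rule power2_le_imp_le) simp
    then show ?thesis
      using nz[OF that] by (simp add: f_def norm_divide divide_simps)
  qed
  have sp: "cmod (f z - f w) \<le> k * cmod (1 - cnj (f w) * f z)"
    by (rule schwarz_pick_bidisk[OF hol bd z w k assms(7,8)])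
  define N where "N = cmod (F z + 1) * cmod (F w + 1)"
  have N: "N > 0" using nz[OF z] nz[OF w] by (simp add: N_def)
  have nzc: "cnj (F w) + 1 \<noteq> 0"
    using nz[OF w] by (metis complex_cnj_add complex_cnj_one complex_cnj_zero_iff)
  have cN: "cmod (cnj (F w) + 1) = cmod (F w + 1)"
    by (metis complex_cnj_add complex_cnj_one complex_mod_cnj)
  have "f z - f w = 2 * (F z - F w) / ((F z + 1) * (F w + 1))"
    using nz[OF z] nz[OF w] by (simp add: f_def field_simps)
  then have e1: "cmod (f z - f w) = 2 * cmod (F z - F w) / N"
    by (simp only: norm_divide norm_mult N_def norm_numeral)
  have "1 - cnj (f w) * f z = 2 * (F z + cnj (F w)) / ((F z + 1) * (cnj (F w) + 1))"
    unfolding f_def complex_cnj_divide complex_cnj_diff complex_cnj_add complex_cnj_one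
    using nz[OF z] nzc by (simp add: divide_simps) (simp add: algebra_simps)
  then have e2: "cmod (1 - cnj (f w) * f z) = 2 * cmod (F z + cnj (F w)) / N"
    by (simp only: norm_divide norm_mult N_def cN norm_numeral)
  have "cmod (F z - F w) \<le> k * cmod (F z + cnj (F w))"
    using sp N unfolding e1 e2 by (simp add: field_simps)
  also have "\<dots> \<le> k * (cmod (F z) + cmod (F w))"
    using k norm_triangle_ineq[of "F z" "cnj (F w)"] by (intro mult_left_mono) auto
  finally have "cmod (F z) - cmod (F w) \<le> k * (cmod (F z) + cmod (F w))"
    using norm_triangle_ineq2[of "F z" "F w"] by linarith
  then show ?thesis
    using k by (simp add: field_simps)
qed

lemma pseudohyperbolic_le:
  assumes "m * (cmod (1 - cnj b * a))\<^sup>2 \<le> (1 - (cmod a)\<^sup>2) * (1 - (cmod b)\<^sup>2)" "m \<le> 1"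
  shows "cmod (a - b) \<le> sqrt (1 - m) * cmod (1 - cnj b * a)"
proof (rule power2_le_imp_le)
  show "(cmod (a - b))\<^sup>2 \<le> (sqrt (1 - m) * cmod (1 - cnj b * a))\<^sup>2"
    using assms pseudohyperbolic_identity[of b a] by (simp add: power_mult_distrib algebra_simps)
qed (use assms in simp)

text \<open>Schwarz--Pick in terms of \<open>m = 1 - k\<^sup>2\<close>, the form in which a limit \<open>k \<longlonglongrightarrow> 1\<close> still
  carries information.\<close>

lemma schwarz_pick_bidisk_squared:
  assumes f: "disc_holomorphic f" and b: "\<And>z. z \<in> bidisk \<Longrightarrow> cmod (f z) \<le> 1"
    and z: "z \<in> bidisk" and w: "w \<in> bidisk" and m: "0 < m" "m < 1"
    and "m * (cmod (1 - cnj (fst w) * fst z))\<^sup>2 \<le> (1 - (cmod (fst z))\<^sup>2) * (1 - (cmod (fst w))\<^sup>2)"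
    and "m * (cmod (1 - cnj (snd w) * snd z))\<^sup>2 \<le> (1 - (cmod (snd z))\<^sup>2) * (1 - (cmod (snd w))\<^sup>2)"
  shows "m * (cmod (1 - cnj (f w) * f z))\<^sup>2 \<le> (1 - (cmod (f z))\<^sup>2) * (1 - (cmod (f w))\<^sup>2)"
proof -
  have "cmod (f z - f w) \<le> sqrt (1 - m) * cmod (1 - cnj (f w) * f z)"
    using m by (intro schwarz_pick_bidisk[OF f b z w] pseudohyperbolic_le assms(7,8)) auto
  then have "(cmod (f z - f w))\<^sup>2 \<le> (sqrt (1 - m) * cmod (1 - cnj (f w) * f z))\<^sup>2"
    by (intro power_mono) auto
  then show ?thesis
    using m pseudohyperbolic_identity[of "f w" "f z"] by (simp add: power_mult_distrib algebra_simps)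
qed

section \<open>Approach regions\<close>

lemma frontier_bidisk: "frontier bidisk = {z. maxnorm z = 1}"
proof -
  have "open bidisk"
    by (simp add: bidisk_def open_Times)
  then have "frontier bidisk = cball 0 1 \<times> cball 0 1 - bidisk"
    by (simp add: frontier_def interior_open bidisk_def closure_Times closure_ball)
  moreover have "z \<in> cball 0 1 \<times> cball 0 1 - bidisk \<longleftrightarrow> maxnorm z = 1" for z
    by (cases z) (auto simp: maxnorm_def bidisk_def)
  ultimately show ?thesis
    by blast
qed

text \<open>The first coordinate can be moved radially onto the circle, which leaves the bidisk.\<close>

lemma maxdist_le:
  assumes "z \<in> bidisk"
  shows "maxdist z (- bidisk) \<le> 1 - cmod (fst z)"
proof -
  obtain u where u: "cmod u = 1" "cmod (fst z - u) = 1 - cmod (fst z)"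
  proof (cases "fst z = 0")
    case True
    then show ?thesis by (intro that[of 1]) auto
  next
    case False
    then have "fst z - sgn (fst z) = of_real (cmod (fst z) - 1) * sgn (fst z)"
      by (simp add: sgn_eq divide_simps) (simp add: algebra_simps)
    then have "cmod (fst z - sgn (fst z)) = 1 - cmod (fst z)"
      using assms False by (simp only: norm_mult) (simp add: norm_sgn mem_bidisk del: of_real_diff)
    with False show ?thesis by (intro that[of "sgn (fst z)"]) (auto simp: norm_sgn)
  qed
  have "maxdist z (- bidisk) \<le> maxnorm (z - (u, snd z))"
    unfolding maxdist_def
  proof (rule cINF_lower)
    show "bdd_below ((\<lambda>w. maxnorm (z - w)) ` (- bidisk))"
      by (rule bdd_belowI[of _ 0]) (auto simp: maxnorm_def le_max_iff_disj)
    show "(u, snd z) \<in> - bidisk"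
      by (simp add: mem_bidisk u)
  qed
  also have "\<dots> = max (1 - cmod (fst z)) 0"
    by (simp add: maxnorm_def u)
  also have "\<dots> = 1 - cmod (fst z)"
    using assms by (simp add: mem_bidisk)
  finally show ?thesis .
qed

lemma maxdist_ge:
  assumes "m \<le> 1 - cmod (fst z)" "m \<le> 1 - cmod (snd z)"
  shows "m \<le> maxdist z (- bidisk)"
  unfolding maxdist_def
proof (rule cINF_greatest)
  have "(1, 0) \<in> - bidisk" by (simp add: mem_bidisk)
  then show "- bidisk \<noteq> {}" by blast
  fix w assume "w \<in> - bidisk"
  then have "1 \<le> cmod (fst w) \<or> 1 \<le> cmod (snd w)"
    by (auto simp: mem_bidisk)
  then show "m \<le> maxnorm (z - w)"
    using assms norm_triangle_ineq2[of "fst w" "fst z"] norm_triangle_ineq2[of "snd w" "snd z"]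
    by (auto simp: maxnorm_def norm_minus_commute le_max_iff_disj)
qed

text \<open>The distance to the complement of the bidisk is at most \<open>1 - |z\<^sup>1|\<close>, so the first
  coordinates of a nontangential set lie in a Stolz angle.\<close>

lemma approaches_nt_fst:
  assumes "approaches_nt bidisk S \<sigma>"
  obtains c where "1 \<le> c" "\<And>z. z \<in> S \<Longrightarrow> cmod (fst \<sigma> - fst z) \<le> c * (1 - cmod (fst z))"
proof -
  obtain c where S: "S \<subseteq> bidisk" and c: "\<And>z. z \<in> S \<Longrightarrow> maxnorm (z - \<sigma>) / maxdist z (- bidisk) \<le> c"
    using assms by (auto simp: approaches_nt_def)
  have "cmod (fst \<sigma> - fst z) \<le> max 1 c * (1 - cmod (fst z))" if "z \<in> S" for z
  proof -
    have z: "cmod (fst z) < 1" "cmod (snd z) < 1"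
      using S that by (auto simp: mem_bidisk)
    have "0 < min (1 - cmod (fst z)) (1 - cmod (snd z))"
      using z by simp
    also have "\<dots> \<le> maxdist z (- bidisk)"
      by (rule maxdist_ge) auto
    finally have pos: "0 < maxdist z (- bidisk)" .
    have "cmod (fst \<sigma> - fst z) \<le> maxnorm (z - \<sigma>)"
      by (simp add: maxnorm_def norm_minus_commute)
    also have "\<dots> \<le> c * maxdist z (- bidisk)"
      using c[OF that] pos by (simp add: field_simps)
    also have "\<dots> \<le> max 1 c * maxdist z (- bidisk)"
      using pos by (intro mult_right_mono) auto
    also have "\<dots> \<le> max 1 c * (1 - cmod (fst z))"
      using that S by (intro mult_left_mono maxdist_le) auto
    finally show ?thesis .
  qed
  then show ?thesis
    by (intro that[of "max 1 c"]) auto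
qed

lemma filterlim_ray:
  fixes \<sigma> v :: "'a::real_normed_vector"
  assumes "v \<noteq> 0" and "\<forall>\<^sub>F e in at_right 0. \<sigma> + e *\<^sub>R v \<in> S"
  shows "filterlim (\<lambda>e. \<sigma> + e *\<^sub>R v) (at \<sigma> within S) (at_right 0)"
  unfolding filterlim_at
proof
  have "\<forall>\<^sub>F e in at_right 0. (0::real) < e"
    by (simp add: eventually_at_right_less)
  with assms(2) show "\<forall>\<^sub>F e in at_right 0. \<sigma> + e *\<^sub>R v \<in> S \<and> \<sigma> + e *\<^sub>R v \<noteq> \<sigma>"
    by eventually_elim (use \<open>v \<noteq> 0\<close> in auto)
  show "((\<lambda>e. \<sigma> + e *\<^sub>R v) \<longlongrightarrow> \<sigma>) (at_right 0)"
    by (auto intro!: tendsto_eq_intros)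
qed

text \<open>Segments into the bidisk are the test sets that show limits and gradients to be
  unique.\<close>

lemma approaches_nt_ray:
  assumes \<sigma>: "maxnorm \<sigma> = 1" and v: "maxnorm v = 1" and e0: "0 < e0"
    and *: "\<And>e. 0 < e \<Longrightarrow> e < e0 \<Longrightarrow> maxnorm (\<sigma> + e *\<^sub>R v) \<le> 1 - e"
  shows "approaches_nt bidisk ((\<lambda>e. \<sigma> + e *\<^sub>R v) ` {0<..<e0}) \<sigma>" (is "approaches_nt _ ?S _")
    and "filterlim (\<lambda>e. \<sigma> + e *\<^sub>R v) (at \<sigma> within (\<lambda>e. \<sigma> + e *\<^sub>R v) ` {0<..<e0}) (at_right 0)"
proof -
  have "v \<noteq> 0" using v by (auto simp: maxnorm_def)
  have ev: "\<forall>\<^sub>F e in at_right 0. \<sigma> + e *\<^sub>R v \<in> ?S"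
    using eventually_at_right_real[OF e0] by eventually_elim auto
  then show lim: "filterlim (\<lambda>e. \<sigma> + e *\<^sub>R v) (at \<sigma> within ?S) (at_right 0)"
    using \<open>v \<noteq> 0\<close> by (intro filterlim_ray)
  have "\<sigma> \<in> closure ?S"
  proof (rule Lim_in_closed_set[OF closed_closure])
    show "\<forall>\<^sub>F e in at_right 0. \<sigma> + e *\<^sub>R v \<in> closure ?S"
      using ev by (rule eventually_mono) (rule subsetD[OF closure_subset])
    show "((\<lambda>e. \<sigma> + e *\<^sub>R v) \<longlongrightarrow> \<sigma>) (at_right 0)"
      by (auto intro!: tendsto_eq_intros)
  qed simp
  moreover have "?S \<subseteq> bidisk"
    using * by (force simp: mem_bidisk maxnorm_def)
  moreover have "maxnorm (z - \<sigma>) / maxdist z (- bidisk) \<le> 1" if "z \<in> ?S" for z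
  proof -
    from that obtain e where "e \<in> {0<..<e0}" and ez: "z = \<sigma> + e *\<^sub>R v"
      by blast
    then have e: "0 < e" "e < e0" by simp_all
    have "e \<le> maxdist z (- bidisk)"
      using *[OF e] ez by (intro maxdist_ge) (auto simp: maxnorm_def)
    moreover have "maxnorm (z - \<sigma>) = e * maxnorm v"
      using e ez by (simp add: maxnorm_def max_mult_distrib_left)
    ultimately show ?thesis
      using e v by simp
  qed
  ultimately show "approaches_nt bidisk ?S \<sigma>"
    using \<sigma> unfolding approaches_nt_def frontier_bidisk by blast
qed

section \<open>Julia's inequality\<close>

lemma julia_liminf_nonneg:
  assumes "\<And>z. z \<in> bidisk \<Longrightarrow> cmod (\<phi> z) \<le> 1"
  shows "0 \<le> julia_liminf \<phi> \<tau>"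
  unfolding julia_liminf_def
proof (rule Liminf_bounded)
  have "0 \<le> ereal ((1 - cmod (\<phi> z)) / (1 - maxnorm z))" if "z \<in> bidisk" for z
    using assms[OF that] that by (simp add: mem_bidisk maxnorm_def)
  then show "\<forall>\<^sub>F z in at \<tau> within bidisk. 0 \<le> ereal ((1 - cmod (\<phi> z)) / (1 - maxnorm z))"
    by (auto simp: eventually_at intro!: exI[of _ 1])
qed

lemma julia_liminf_sequence:
  assumes b: "\<And>z. z \<in> bidisk \<Longrightarrow> cmod (\<phi> z) \<le> 1" and \<alpha>: "julia_liminf \<phi> \<tau> = ereal \<alpha>"
  obtains \<mu> c \<omega> where "\<mu> \<longlonglongrightarrow> \<tau>" "c \<longlonglongrightarrow> 0" "(\<lambda>n. \<phi> (\<mu> n)) \<longlonglongrightarrow> \<omega>" "\<And>n::nat. \<mu> n \<in> bidisk"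
    "\<And>n. 1 - cmod (\<phi> (\<mu> n)) \<le> (\<alpha> + c n) * (1 - maxnorm (\<mu> n))"
proof -
  have "\<exists>z\<in>bidisk. dist z \<tau> < e \<and> 1 - cmod (\<phi> z) \<le> (\<alpha> + e) * (1 - maxnorm z)" if "e > 0" for e
  proof (rule ccontr)
    assume no: "\<not> ?thesis"
    have "ereal (\<alpha> + e) \<le> julia_liminf \<phi> \<tau>"
      unfolding julia_liminf_def
    proof (rule Liminf_bounded)
      have "ereal (\<alpha> + e) \<le> ereal ((1 - cmod (\<phi> z)) / (1 - maxnorm z))"
        if "z \<in> bidisk" "dist z \<tau> < e" for z
      proof -
        have "(\<alpha> + e) * (1 - maxnorm z) \<le> 1 - cmod (\<phi> z)"
          using no that by force
        moreover have "maxnorm z < 1"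
          using that by (simp add: mem_bidisk maxnorm_def)
        ultimately show ?thesis by (simp add: field_simps)
      qed
      then show "\<forall>\<^sub>F z in at \<tau> within bidisk. ereal (\<alpha> + e) \<le> ereal ((1 - cmod (\<phi> z)) / (1 - maxnorm z))"
        using \<open>e > 0\<close> by (auto simp: eventually_at)
    qed
    with \<alpha> \<open>e > 0\<close> show False by simp
  qed
  then have "\<forall>n::nat. \<exists>z. z \<in> bidisk \<and> dist z \<tau> < inverse (Suc n) \<and>
      1 - cmod (\<phi> z) \<le> (\<alpha> + inverse (Suc n)) * (1 - maxnorm z)"
    by (meson inverse_positive_iff_positive of_nat_0_less_iff zero_less_Suc)
  then obtain l where l: "\<And>n::nat. l n \<in> bidisk" "\<And>n. dist (l n) \<tau> < inverse (Suc n)"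
    "\<And>n. 1 - cmod (\<phi> (l n)) \<le> (\<alpha> + inverse (Suc n)) * (1 - maxnorm (l n))"
    by metis
  have "(\<lambda>n. dist (l n) \<tau>) \<longlonglongrightarrow> 0"
    by (rule tendsto_sandwich[OF _ _ tendsto_const LIMSEQ_inverse_real_of_nat])
       (use l(2) in \<open>auto intro!: always_eventually less_imp_le\<close>)
  then have lim: "l \<longlonglongrightarrow> \<tau>"
    by (rule iffD2[OF tendsto_dist_iff])
  have "\<forall>n. (\<phi> \<circ> l) n \<in> cball 0 1"
    using l(1) b by simp
  then obtain \<omega> r where r: "strict_mono r" "((\<phi> \<circ> l) \<circ> r) \<longlonglongrightarrow> \<omega>"
    using compact_cball[of "0::complex" 1] unfolding compact_def by metis
  show thesis
  proof
    show "(l \<circ> r) \<longlonglongrightarrow> \<tau>"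
      by (rule LIMSEQ_subseq_LIMSEQ[OF lim r(1)])
    show "((\<lambda>n. inverse (real (Suc n))) \<circ> r) \<longlonglongrightarrow> 0"
      by (rule LIMSEQ_subseq_LIMSEQ[OF LIMSEQ_inverse_real_of_nat r(1)])
    show "(\<lambda>n. \<phi> ((l \<circ> r) n)) \<longlonglongrightarrow> \<omega>"
      using r(2) by (simp add: o_def)
  qed (use l in auto)
qed

lemma norm_one_minus_cnj_unit:
  assumes "cmod \<omega> = 1"
  shows "cmod (1 - cnj \<omega> * z) = cmod (\<omega> - z)"
proof -
  have "cnj \<omega> * \<omega> = 1"
    using assms complex_norm_square[of \<omega>] by (simp add: mult.commute)
  then have "1 - cnj \<omega> * z = cnj \<omega> * (\<omega> - z)"
    by (simp add: right_diff_distrib)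
  then show ?thesis
    using assms by (simp add: norm_mult)
qed

text \<open>Julia's inequality at the boundary value \<open>t\<close> of the first coordinate. Multiplied out, it
  keeps its meaning where \<open>\<phi>\<close> takes the value \<open>\<omega>\<close>.\<close>

definition julia_bound ::
  "(complex \<times> complex \<Rightarrow> complex) \<Rightarrow> complex \<Rightarrow> complex \<Rightarrow> real \<Rightarrow> bool" where
  "julia_bound \<phi> t \<omega> \<alpha> \<longleftrightarrow>
     (\<forall>z\<in>bidisk. (cmod (\<omega> - \<phi> z))\<^sup>2 * (1 - (cmod (fst z))\<^sup>2)
        \<le> \<alpha> * (cmod (t - fst z))\<^sup>2 * (1 - (cmod (\<phi> z))\<^sup>2))"

text \<open>Let \<open>m\<close> denote one minus the squared pseudohyperbolic distance, separately in each
  coordinate, between \<open>z\<close> and the points \<open>\<mu> n\<close> realising the lower limit. It tends to \<open>0\<close> in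
  the first coordinate and to a positive number in the second, so eventually the first one
  governs Schwarz--Pick. Both sides of the latter then vanish to first order, and dividing by
  \<open>1 - |fst (\<mu> n)|\<close> before passing to the limit leaves \<open>\<alpha>\<close> as the quotient.\<close>

lemma julia_inequality:
  assumes f: "disc_holomorphic \<phi>" and b: "\<And>z. z \<in> bidisk \<Longrightarrow> cmod (\<phi> z) \<le> 1"
    and \<tau>: "cmod (fst \<tau>) = 1" "cmod (snd \<tau>) < 1" and \<alpha>: "julia_liminf \<phi> \<tau> = ereal \<alpha>"
  obtains \<omega> where "cmod \<omega> = 1" "julia_bound \<phi> (fst \<tau>) \<omega> \<alpha>"
proof -
  obtain \<mu> c \<omega> where \<mu>: "\<mu> \<longlonglongrightarrow> \<tau>" and c: "c \<longlonglongrightarrow> 0" and \<omega>: "(\<lambda>n. \<phi> (\<mu> n)) \<longlonglongrightarrow> \<omega>"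
    and \<mu>b: "\<And>n::nat. \<mu> n \<in> bidisk"
    and le: "\<And>n. 1 - cmod (\<phi> (\<mu> n)) \<le> (\<alpha> + c n) * (1 - maxnorm (\<mu> n))"
    using julia_liminf_sequence[OF b \<alpha>] by blast
  have le1: "1 - cmod (\<phi> (\<mu> n)) \<le> (\<alpha> + c n) * (1 - cmod (fst (\<mu> n)))" for n
  proof -
    have pos: "0 < 1 - maxnorm (\<mu> n)"
      using \<mu>b[of n] by (simp add: mem_bidisk maxnorm_def)
    have "0 \<le> (\<alpha> + c n) * (1 - maxnorm (\<mu> n))"
      using le[of n] b[OF \<mu>b[of n]] by linarith
    then have "0 \<le> \<alpha> + c n"
      using pos by (simp add: zero_le_mult_iff)
    then have "(\<alpha> + c n) * (1 - maxnorm (\<mu> n)) \<le> (\<alpha> + c n) * (1 - cmod (fst (\<mu> n)))"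
      by (intro mult_left_mono) (auto simp: maxnorm_def)
    then show ?thesis using le[of n] by linarith
  qed
  \<comment> \<open>The bound on the quotients squeezes the limit of the values onto the circle.\<close>
  have \<omega>1: "cmod \<omega> = 1"
  proof (rule antisym)
    show "cmod \<omega> \<le> 1"
      by (rule tendsto_le[OF _ tendsto_const tendsto_norm[OF \<omega>]]) (auto intro!: always_eventually b \<mu>b)
    have "1 - cmod \<omega> \<le> 0"
    proof (rule tendsto_le)
      show "(\<lambda>n. 1 - cmod (\<phi> (\<mu> n))) \<longlonglongrightarrow> 1 - cmod \<omega>"
        by (intro tendsto_intros \<omega>)
      show "(\<lambda>n. (\<alpha> + c n) * (1 - cmod (fst (\<mu> n)))) \<longlonglongrightarrow> 0"
        using \<tau> by (auto intro!: tendsto_eq_intros c \<mu>)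
    qed (use le1 in \<open>auto intro!: always_eventually\<close>)
    then show "1 \<le> cmod \<omega>" by simp
  qed
  have "(cmod (\<omega> - \<phi> z))\<^sup>2 * (1 - (cmod (fst z))\<^sup>2)
       \<le> \<alpha> * (cmod (fst \<tau> - fst z))\<^sup>2 * (1 - (cmod (\<phi> z))\<^sup>2)" if z: "z \<in> bidisk" for z
  proof -
    define D where "D i n = (cmod (1 - cnj (i (\<mu> n)) * i z))\<^sup>2" for i :: "complex \<times> complex \<Rightarrow> complex" and n
    define m where "m i n = (1 - (cmod (i z))\<^sup>2) * (1 - (cmod (i (\<mu> n)))\<^sup>2) / D i n"
      for i :: "complex \<times> complex \<Rightarrow> complex" and n
    have D: "D i n > 0" if "i \<in> {fst, snd}" for i n
      using one_minus_cnj_mult_neq_0[of "i z" "i (\<mu> n)"] that z \<mu>b[of n] by (auto simp: D_def mem_bidisk)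
    have m: "m i n > 0" if "i \<in> {fst, snd}" for i n
      using that z \<mu>b[of n] D[OF that, of n]
      by (auto simp: m_def mem_bidisk power_less_one_iff intro!: divide_pos_pos mult_pos_pos)
    have nz1: "1 - cnj (fst \<tau>) * fst z \<noteq> 0"
      using one_minus_cnj_mult_neq_0[of "cnj (fst \<tau>)" "cnj (fst z)"] \<tau> z
      by (simp add: mem_bidisk mult.commute)
    have nz2: "1 - cnj (snd \<tau>) * snd z \<noteq> 0"
      using one_minus_cnj_mult_neq_0[of "snd z" "snd \<tau>"] \<tau> z by (simp add: mem_bidisk)
    have m1: "m fst \<longlonglongrightarrow> 0"
      unfolding m_def D_def using nz1 \<tau> by (auto intro!: tendsto_eq_intros \<mu>)
    define L where "L = (1 - (cmod (snd z))\<^sup>2) * (1 - (cmod (snd \<tau>))\<^sup>2) / (cmod (1 - cnj (snd \<tau>) * snd z))\<^sup>2"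
    have m2: "m snd \<longlonglongrightarrow> L"
      unfolding m_def D_def L_def using nz2 by (intro tendsto_intros \<mu>) auto
    have "L > 0"
      unfolding L_def using nz2 z \<tau>
      by (intro divide_pos_pos mult_pos_pos) (auto simp: mem_bidisk power_less_one_iff)
    have "\<forall>\<^sub>F n in sequentially. m fst n < min 1 (L / 2)"
      using \<open>L > 0\<close> by (intro order_tendstoD[OF m1]) auto
    moreover have "\<forall>\<^sub>F n in sequentially. L / 2 < m snd n"
      using \<open>L > 0\<close> by (intro order_tendstoD[OF m2]) auto
    ultimately have ev: "\<forall>\<^sub>F n in sequentially.
       (cmod (1 - cnj (\<phi> (\<mu> n)) * \<phi> z))\<^sup>2 * ((1 - (cmod (fst z))\<^sup>2) * (1 + cmod (fst (\<mu> n))))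
       \<le> (\<alpha> + c n) * (1 + cmod (\<phi> (\<mu> n))) * (cmod (1 - cnj (fst (\<mu> n)) * fst z))\<^sup>2 * (1 - (cmod (\<phi> z))\<^sup>2)"
    proof eventually_elim
      case (elim n)
      have "m fst n * D snd n \<le> m snd n * D snd n"
        using elim D[of snd n] by (intro mult_right_mono) auto
      then have s2: "m fst n * D snd n \<le> (1 - (cmod (snd z))\<^sup>2) * (1 - (cmod (snd (\<mu> n)))\<^sup>2)"
        using D[of snd n] by (simp add: m_def[of snd])
      have s1: "m fst n * D fst n \<le> (1 - (cmod (fst z))\<^sup>2) * (1 - (cmod (fst (\<mu> n)))\<^sup>2)"
        using D[of fst n] by (simp add: m_def)
      have "m fst n * (cmod (1 - cnj (\<phi> (\<mu> n)) * \<phi> z))\<^sup>2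
          \<le> (1 - (cmod (\<phi> z))\<^sup>2) * (1 - (cmod (\<phi> (\<mu> n)))\<^sup>2)"
        using elim m[of fst n] s1 s2 unfolding D_def
        by (intro schwarz_pick_bidisk_squared[OF f b z \<mu>b]) simp_all
      then have "(cmod (1 - cnj (\<phi> (\<mu> n)) * \<phi> z))\<^sup>2 * ((1 - (cmod (fst z))\<^sup>2) * (1 - (cmod (fst (\<mu> n)))\<^sup>2))
          \<le> (1 - (cmod (\<phi> z))\<^sup>2) * (1 - (cmod (\<phi> (\<mu> n)))\<^sup>2) * D fst n"
        using D[of fst n] by (simp add: m_def field_simps)
      also have "\<dots> \<le> (1 - (cmod (\<phi> z))\<^sup>2) * ((\<alpha> + c n) * (1 - cmod (fst (\<mu> n))) * (1 + cmod (\<phi> (\<mu> n)))) * D fst n"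
      proof (intro mult_right_mono mult_left_mono)
        have "1 - (cmod (\<phi> (\<mu> n)))\<^sup>2 = (1 - cmod (\<phi> (\<mu> n))) * (1 + cmod (\<phi> (\<mu> n)))"
          by (simp add: power2_eq_square algebra_simps)
        then show "1 - (cmod (\<phi> (\<mu> n)))\<^sup>2 \<le> (\<alpha> + c n) * (1 - cmod (fst (\<mu> n))) * (1 + cmod (\<phi> (\<mu> n)))"
          using mult_right_mono[OF le1[of n], of "1 + cmod (\<phi> (\<mu> n))"] by simp
      qed (use b[OF z] D[of fst n] in \<open>auto simp: power_le_one\<close>)
      \<comment> \<open>The factor that tends to zero is isolated on both sides.\<close>
      finally have "(1 - cmod (fst (\<mu> n))) * ((cmod (1 - cnj (\<phi> (\<mu> n)) * \<phi> z))\<^sup>2 *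
            ((1 - (cmod (fst z))\<^sup>2) * (1 + cmod (fst (\<mu> n)))))
          \<le> (1 - cmod (fst (\<mu> n))) * ((\<alpha> + c n) * (1 + cmod (\<phi> (\<mu> n))) * D fst n * (1 - (cmod (\<phi> z))\<^sup>2))"
        by (simp add: power2_eq_square[of "cmod (fst (\<mu> n))"] algebra_simps)
      then show ?case
        using \<mu>b[of n] by (simp add: mem_bidisk D_def)
    qed
    have "(cmod (1 - cnj \<omega> * \<phi> z))\<^sup>2 * ((1 - (cmod (fst z))\<^sup>2) * (1 + cmod (fst \<tau>)))
       \<le> (\<alpha> + 0) * (1 + cmod \<omega>) * (cmod (1 - cnj (fst \<tau>) * fst z))\<^sup>2 * (1 - (cmod (\<phi> z))\<^sup>2)"
      by (rule tendsto_le[OF _ _ _ ev]) (intro tendsto_intros \<mu> \<omega> c sequentially_bot)+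
    then have "2 * ((cmod (\<omega> - \<phi> z))\<^sup>2 * (1 - (cmod (fst z))\<^sup>2))
       \<le> 2 * (\<alpha> * (cmod (fst \<tau> - fst z))\<^sup>2 * (1 - (cmod (\<phi> z))\<^sup>2))"
      unfolding norm_one_minus_cnj_unit[OF \<omega>1] norm_one_minus_cnj_unit[OF \<tau>(1)] \<omega>1 \<tau>(1)
      by (simp add: algebra_simps)
    then show ?thesis by linarith
  qed
  with \<omega>1 show ?thesis
    by (intro that[of \<omega>]) (auto simp: julia_bound_def)
qed

section \<open>Boundary behaviour along a radius\<close>

text \<open>The radius to \<open>\<sigma>\<close>, parametrised by the distance \<open>e\<close> to the boundary.\<close>

lemma ray_toward_origin:
  fixes \<sigma> :: "complex \<times> complex"
  assumes "cmod (fst \<sigma>) = 1" "cmod (snd \<sigma>) \<le> 1"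
  shows "maxnorm \<sigma> = 1"
    and "0 < e \<Longrightarrow> e < 1 \<Longrightarrow> maxnorm ((1 - e) *\<^sub>R \<sigma>) = 1 - e"
    and "0 < e \<Longrightarrow> e < 1 \<Longrightarrow> (1 - e) *\<^sub>R \<sigma> \<in> bidisk"
    and "filterlim (\<lambda>e. (1 - e) *\<^sub>R \<sigma>) (at \<sigma> within bidisk) (at_right 0)"
proof -
  show 1: "maxnorm \<sigma> = 1"
    using assms by (simp add: maxnorm_def)
  show 2: "maxnorm ((1 - e) *\<^sub>R \<sigma>) = 1 - e" if "0 < e" "e < 1" for e
  proof -
    have "maxnorm ((1 - e) *\<^sub>R \<sigma>) = (1 - e) * maxnorm \<sigma>"
      using that by (simp add: maxnorm_def max_mult_distrib_left)
    with 1 show ?thesis by simp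
  qed
  show 3: "(1 - e) *\<^sub>R \<sigma> \<in> bidisk" if "0 < e" "e < 1" for e
  proof -
    have "max (cmod (fst ((1 - e) *\<^sub>R \<sigma>))) (cmod (snd ((1 - e) *\<^sub>R \<sigma>))) < 1"
      using 2[OF that] that unfolding maxnorm_def by simp
    then show ?thesis
      unfolding mem_bidisk max_less_iff_conj .
  qed
  have "\<sigma> \<noteq> 0"
    using 1 by (auto simp: maxnorm_def)
  moreover have "\<forall>\<^sub>F e in at_right 0. \<sigma> + e *\<^sub>R (- \<sigma>) \<in> bidisk"
    using eventually_at_right_real[OF zero_less_one]
    by (rule eventually_mono) (use 3 in \<open>simp add: scaleR_left_diff_distrib\<close>)
  ultimately have "filterlim (\<lambda>e. \<sigma> + e *\<^sub>R (- \<sigma>)) (at \<sigma> within bidisk) (at_right 0)"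
    by (intro filterlim_ray) auto
  then show "filterlim (\<lambda>e. (1 - e) *\<^sub>R \<sigma>) (at \<sigma> within bidisk) (at_right 0)"
    by (simp add: scaleR_left_diff_distrib)
qed

text \<open>On a radius the inequality of Julia contains the factor \<open>1 - |\<phi>|\<close>, which is at most
  \<open>|\<omega> - \<phi>|\<close>; one factor \<open>|\<omega> - \<phi>|\<close> cancels and a linear bound remains.\<close>

lemma julia_radial:
  assumes J: "julia_bound \<phi> (fst \<sigma>) \<omega> \<alpha>" and b: "\<And>z. z \<in> bidisk \<Longrightarrow> cmod (\<phi> z) \<le> 1"
    and \<omega>: "cmod \<omega> = 1" and "0 \<le> \<alpha>"
    and \<sigma>: "cmod (fst \<sigma>) = 1" "cmod (snd \<sigma>) \<le> 1" and e: "0 < e" "e < 1"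
  shows "1 - cmod (\<phi> ((1 - e) *\<^sub>R \<sigma>)) \<le> cmod (\<omega> - \<phi> ((1 - e) *\<^sub>R \<sigma>))"
    and "cmod (\<omega> - \<phi> ((1 - e) *\<^sub>R \<sigma>)) / e \<le> 2 * \<alpha> / (2 - e)"
proof -
  define p where "p = \<phi> ((1 - e) *\<^sub>R \<sigma>)"
  define x where "x = cmod (\<omega> - p)"
  have dx: "1 - cmod p \<le> x"
    using norm_triangle_ineq2[of \<omega> p] \<omega> by (simp add: x_def)
  then show "1 - cmod (\<phi> ((1 - e) *\<^sub>R \<sigma>)) \<le> cmod (\<omega> - \<phi> ((1 - e) *\<^sub>R \<sigma>))"
    by (simp add: x_def p_def)
  note z = ray_toward_origin(3)[OF \<sigma> e]
  have "fst \<sigma> - fst ((1 - e) *\<^sub>R \<sigma>) = e *\<^sub>R fst \<sigma>"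
    by (simp add: scaleR_left_diff_distrib)
  then have t: "cmod (fst \<sigma> - fst ((1 - e) *\<^sub>R \<sigma>)) = e"
    using \<sigma> e by simp
  have r: "cmod (fst ((1 - e) *\<^sub>R \<sigma>)) = 1 - e"
    using \<sigma> e by simp
  have "x\<^sup>2 * (1 - (1 - e)\<^sup>2) \<le> \<alpha> * e\<^sup>2 * (1 - (cmod p)\<^sup>2)"
    using J[unfolded julia_bound_def, rule_format, OF z] unfolding t r p_def[symmetric] x_def[symmetric] .
  also have "\<dots> \<le> \<alpha> * e\<^sup>2 * (2 * x)"
  proof (intro mult_left_mono)
    have "(1 - cmod p) * (1 + cmod p) \<le> x * 2"
      using b[OF z] dx by (intro mult_mono) (auto simp: p_def x_def)
    then show "1 - (cmod p)\<^sup>2 \<le> 2 * x"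
      by (simp add: power2_eq_square algebra_simps)
  qed (use \<open>0 \<le> \<alpha>\<close> in simp)
  finally have "(x * e) * (x * (2 - e)) \<le> (x * e) * (2 * \<alpha> * e)"
    by (simp add: power2_eq_square algebra_simps)
  then have "x * (2 - e) \<le> 2 * \<alpha> * e"
    using e \<open>0 \<le> \<alpha>\<close> by (cases "x = 0") (auto simp: x_def)
  then have "x / e \<le> 2 * \<alpha> / (2 - e)"
    using e by (simp add: divide_simps mult_ac)
  then show "cmod (\<omega> - \<phi> ((1 - e) *\<^sub>R \<sigma>)) / e \<le> 2 * \<alpha> / (2 - e)"
    by (simp add: x_def p_def)
qed

lemma less_julia_liminfD:
  assumes "ereal a < julia_liminf \<phi> \<sigma>" "cmod (fst \<sigma>) = 1" "cmod (snd \<sigma>) \<le> 1"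
  shows "\<forall>\<^sub>F e in at_right 0. a < (1 - cmod (\<phi> ((1 - e) *\<^sub>R \<sigma>))) / e"
proof -
  have "\<forall>\<^sub>F z in at \<sigma> within bidisk. ereal a < ereal ((1 - cmod (\<phi> z)) / (1 - maxnorm z))"
    using assms(1) unfolding julia_liminf_def by (rule less_LiminfD)
  from eventually_compose_filterlim[OF this ray_toward_origin(4)[OF assms(2,3)]]
    eventually_at_right_real[OF zero_less_one]
  show ?thesis
  proof eventually_elim
    case (elim e)
    then show ?case
      using ray_toward_origin(2)[OF assms(2,3), of e] by simp
  qed
qed

lemma B_pointI:
  assumes J: "julia_bound \<phi> (fst \<sigma>) \<omega> \<alpha>"
    and b: "\<And>z. z \<in> bidisk \<Longrightarrow> cmod (\<phi> z) \<le> 1"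
    and \<omega>: "cmod \<omega> = 1" and \<alpha>: "0 \<le> \<alpha>" and \<sigma>: "cmod (fst \<sigma>) = 1" "cmod (snd \<sigma>) \<le> 1"
  shows "B_point \<phi> \<sigma>"
proof -
  have "\<not> ereal (2 * \<alpha>) < julia_liminf \<phi> \<sigma>"
  proof
    assume "ereal (2 * \<alpha>) < julia_liminf \<phi> \<sigma>"
    from less_julia_liminfD[OF this \<sigma>] eventually_at_right_real[OF zero_less_one]
    have "\<forall>\<^sub>F e in at_right (0::real). False"
    proof eventually_elim
      case (elim e)
      then have e: "0 < e" "e < 1" by auto
      note R = julia_radial[OF J b \<omega> \<alpha> \<sigma> e]
      have "(1 - cmod (\<phi> ((1 - e) *\<^sub>R \<sigma>))) / e \<le> cmod (\<omega> - \<phi> ((1 - e) *\<^sub>R \<sigma>)) / e"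
        using R(1) e by (intro divide_right_mono) auto
      also have "\<dots> \<le> 2 * \<alpha> / (2 - e)" by (rule R(2))
      also have "\<dots> \<le> 2 * \<alpha> / 1"
        using e \<alpha> by (intro divide_left_mono) auto
      finally show False using elim by simp
    qed
    then show False by simp
  qed
  then have "julia_liminf \<phi> \<sigma> \<le> ereal (2 * \<alpha>)" by simp
  also have "\<dots> < \<infinity>" by simp
  finally show ?thesis
    using ray_toward_origin(1)[OF \<sigma>] by (simp add: B_point_def frontier_bidisk)
qed

text \<open>Put \<open>y = (1 - cnj \<omega> \<phi>) / e\<close>. Julia's inequality bounds \<open>|y|\<close> from above by a quantity
  tending to \<open>\<alpha>\<close>, and the lower limit bounds \<open>Re y\<close> from below by one tending to \<open>\<alpha>\<close>. A complex
  number with modulus at most \<open>\<alpha>\<close> and real part at least \<open>\<alpha>\<close> equals \<open>\<alpha>\<close>.\<close>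

lemma radial_derivative:
  assumes J: "julia_bound \<phi> (fst \<tau>) \<omega> \<alpha>"
    and b: "\<And>z. z \<in> bidisk \<Longrightarrow> cmod (\<phi> z) \<le> 1"
    and \<omega>: "cmod \<omega> = 1" and \<alpha>: "0 \<le> \<alpha>" "julia_liminf \<phi> \<tau> = ereal \<alpha>"
    and \<tau>: "cmod (fst \<tau>) = 1" "cmod (snd \<tau>) \<le> 1"
  shows "((\<lambda>e. (\<omega> - \<phi> ((1 - e) *\<^sub>R \<tau>)) / of_real e) \<longlongrightarrow> \<omega> * of_real \<alpha>) (at_right 0)"
proof -
  define d where "d e = (1 - cmod (\<phi> ((1 - e) *\<^sub>R \<tau>))) / e" for e
  define u where "u e = 2 * \<alpha> / (2 - e)" for e :: real
  define y where "y e = (1 - cnj \<omega> * \<phi> ((1 - e) *\<^sub>R \<tau>)) / of_real e" for e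
  have ev: "\<forall>\<^sub>F e in at_right 0. (0::real) < e \<and> e < 1"
    using eventually_at_right_real[OF zero_less_one] by simp
  have pt: "d e \<le> Re (y e) \<and> cmod (y e) \<le> u e" if e: "0 < e" "e < 1" for e
  proof -
    note R = julia_radial[OF J b \<omega> \<alpha>(1) \<tau> e]
    have "cmod (y e) \<le> u e"
      using R(2) e by (simp add: y_def u_def norm_divide norm_one_minus_cnj_unit[OF \<omega>])
    moreover have "Re (cnj \<omega> * \<phi> ((1 - e) *\<^sub>R \<tau>)) \<le> cmod (\<phi> ((1 - e) *\<^sub>R \<tau>))"
      using complex_Re_le_cmod[of "cnj \<omega> * \<phi> ((1 - e) *\<^sub>R \<tau>)"] \<omega> by (simp only: norm_mult) simp
    then have "d e \<le> Re (y e)"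
      using e by (simp only: y_def d_def Re_divide_of_real) (simp add: divide_right_mono)
    ultimately show ?thesis by simp
  qed
  have u: "(u \<longlongrightarrow> \<alpha>) (at_right 0)"
    unfolding u_def by (auto intro!: tendsto_eq_intros)
  have d: "(d \<longlongrightarrow> \<alpha>) (at_right 0)"
  proof (rule order_tendstoI)
    show "\<forall>\<^sub>F e in at_right 0. a < d e" if "a < \<alpha>" for a
      unfolding d_def using less_julia_liminfD[OF _ \<tau>, of a \<phi>] \<alpha> that by simp
    show "\<forall>\<^sub>F e in at_right 0. d e < a" if "\<alpha> < a" for a
      using order_tendstoD(2)[OF u that] ev
    proof eventually_elim
      case (elim e)
      then show ?case
        using pt[of e] complex_Re_le_cmod[of "y e"] by linarith
    qed
  qed
  have "(y \<longlongrightarrow> of_real \<alpha>) (at_right 0)"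
  proof (rule Lim_null[THEN iffD2], rule Lim_null_comparison)
    show "\<forall>\<^sub>F e in at_right 0. cmod (y e - of_real \<alpha>) \<le> sqrt ((u e)\<^sup>2 - 2 * \<alpha> * d e + \<alpha>\<^sup>2)"
      using ev
    proof eventually_elim
      case (elim e)
      have "(cmod (y e - of_real \<alpha>))\<^sup>2 = (cmod (y e))\<^sup>2 - 2 * \<alpha> * Re (y e) + \<alpha>\<^sup>2"
        unfolding cmod_power2 by (simp add: power2_eq_square algebra_simps)
      also have "\<dots> \<le> (u e)\<^sup>2 - 2 * \<alpha> * d e + \<alpha>\<^sup>2"
        using pt[of e] elim \<alpha>
        by (intro add_right_mono diff_mono power_mono mult_left_mono) auto
      finally show ?case
        by (rule real_le_rsqrt)
    qed
    show "((\<lambda>e. sqrt ((u e)\<^sup>2 - 2 * \<alpha> * d e + \<alpha>\<^sup>2)) \<longlongrightarrow> 0) (at_right 0)"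
      by (auto intro!: tendsto_eq_intros u d simp: power2_eq_square)
  qed
  then have "((\<lambda>e. \<omega> * y e) \<longlongrightarrow> \<omega> * of_real \<alpha>) (at_right 0)"
    by (intro tendsto_intros)
  moreover have "\<omega> * y e = (\<omega> - \<phi> ((1 - e) *\<^sub>R \<tau>)) / of_real e" for e
  proof -
    have "\<omega> * cnj \<omega> = 1"
      using \<omega> complex_norm_square[of \<omega>] by simp
    then show ?thesis
      by (simp add: y_def right_diff_distrib mult.assoc[symmetric])
  qed
  ultimately show ?thesis by simp
qed

section \<open>From the radius to nontangential sets\<close>

text \<open>The point \<open>z\<close> is compared with \<open>w = (1 - e) \<tau>\<close> for \<open>e = |fst \<tau> - fst z|\<close>. In the first
  coordinate the pseudohyperbolic distance is controlled by the opening \<open>c\<close> of the Stolz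
  angle; in the second both points stay in the disk of radius \<open>s < 1\<close>.\<close>

lemma harnack_nontangential:
  assumes F: "disc_holomorphic F" and pos: "\<And>z. z \<in> bidisk \<Longrightarrow> 0 \<le> Re (F z)"
    and \<tau>: "cmod (fst \<tau>) = 1" "cmod (snd \<tau>) < 1"
    and lim: "((\<lambda>e. of_real e * F ((1 - e) *\<^sub>R \<tau>)) \<longlongrightarrow> 0) (at_right 0)"
    and \<sigma>: "fst \<sigma> = fst \<tau>" "cmod (snd \<sigma>) < 1" and S: "approaches_nt bidisk S \<sigma>"
  shows "((\<lambda>z. (fst \<tau> - fst z) * F z) \<longlongrightarrow> 0) (at \<sigma> within S)"
proof -
  obtain c where c: "1 \<le> c" "\<And>z. z \<in> S \<Longrightarrow> cmod (fst \<tau> - fst z) \<le> c * (1 - cmod (fst z))"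
    using approaches_nt_fst[OF S] \<sigma> by metis
  have SB: "S \<subseteq> bidisk" using S by (simp add: approaches_nt_def)
  obtain s where s: "cmod (snd \<sigma>) < s" "cmod (snd \<tau>) < s" "s < 1"
    using dense[of "max (cmod (snd \<sigma>)) (cmod (snd \<tau>))" 1] \<sigma> \<tau> by auto
  have s0: "0 < s" using s norm_ge_zero[of "snd \<sigma>"] by linarith
  \<comment> \<open>A lower bound for one minus the squared distance, one entry for each coordinate.\<close>
  define m where "m = min (1 / (4 * c)) ((1 - s\<^sup>2)\<^sup>2 / 4)"
  have s2: "0 < 1 - s\<^sup>2" using s s0 by (simp add: power_less_one_iff)
  have m: "0 < m" "m \<le> 1 / (4 * c)" "4 * m \<le> (1 - s\<^sup>2)\<^sup>2"
    using c(1) s2 by (simp_all add: m_def min_le_iff_disj)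
  have "1 / (4 * c) < 1"
    using c(1) by simp
  with m(2) have m1: "m < 1" by simp
  define k where "k = sqrt (1 - m)"
  have k: "0 < k" "k < 1" using m(1) m1 by (auto simp: k_def)
  define t where "t z = cmod (fst \<tau> - fst z)" for z :: "complex \<times> complex"
  have in_S: "\<forall>\<^sub>F z in at \<sigma> within S. z \<in> S"
    by (simp add: eventually_at_filter)
  have t0: "(t \<longlongrightarrow> 0) (at \<sigma> within S)"
    unfolding t_def by (auto intro!: tendsto_eq_intros simp: \<sigma>)
  have tpos: "0 < t z" if "z \<in> S" for z
  proof -
    have "fst z \<noteq> fst \<tau>" using that SB \<tau> by (auto simp: mem_bidisk)
    then show ?thesis by (simp add: t_def)
  qed
  have tlim: "filterlim t (at_right 0) (at \<sigma> within S)"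
    unfolding filterlim_at using t0 in_S by (auto elim!: eventually_mono dest: tpos)
  have "((\<lambda>z. cmod (snd z)) \<longlongrightarrow> cmod (snd \<sigma>)) (at \<sigma> within S)"
    by (intro tendsto_intros)
  then have evs: "\<forall>\<^sub>F z in at \<sigma> within S. cmod (snd z) < s"
    using s by (intro order_tendstoD)
  have evt: "\<forall>\<^sub>F z in at \<sigma> within S. t z < 1"
    using t0 by (intro order_tendstoD) auto
  show ?thesis
  proof (rule Lim_null_comparison)
    show "\<forall>\<^sub>F z in at \<sigma> within S. cmod ((fst \<tau> - fst z) * F z)
        \<le> (1 + k) / (1 - k) * cmod (of_real (t z) * F ((1 - t z) *\<^sub>R \<tau>))"
      using in_S evs evt
    proof eventually_elim
      case (elim z)
      define e where "e = t z"
      define w where "w = (1 - e) *\<^sub>R \<tau>"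
      have e: "0 < e" "e < 1" using elim tpos by (auto simp: e_def)
      have zB: "z \<in> bidisk" using elim SB by auto
      then have z: "cmod (fst z) < 1" "cmod (snd z) < 1" by (auto simp: mem_bidisk)
      have wB: "w \<in> bidisk"
        unfolding w_def using \<tau> e by (intro ray_toward_origin) auto
      have w1: "cmod (fst w) = 1 - e" using \<tau> e by (simp add: w_def)
      have "cmod (snd w) = (1 - e) * cmod (snd \<tau>)" using e by (simp add: w_def)
      also have "\<dots> \<le> 1 * cmod (snd \<tau>)" using e by (intro mult_right_mono) auto
      finally have w2: "cmod (snd w) \<le> s" using s by simp
      have ec: "e / c \<le> 1 - cmod (fst z)"
        using c elim by (simp add: e_def t_def divide_simps mult.commute)
      have "cmod (1 - cnj (fst w) * fst z) = cmod ((1 - cnj (fst \<tau>) * fst z) + e *\<^sub>R (cnj (fst \<tau>) * fst z))"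
        by (simp add: w_def algebra_simps)
      also have "\<dots> \<le> cmod (1 - cnj (fst \<tau>) * fst z) + cmod (e *\<^sub>R (cnj (fst \<tau>) * fst z))"
        by (rule norm_triangle_ineq)
      also have "\<dots> \<le> e + e * 1"
      proof (rule add_mono)
        show "cmod (1 - cnj (fst \<tau>) * fst z) \<le> e"
          using norm_one_minus_cnj_unit[OF \<tau>(1)] by (simp add: e_def t_def)
        have "e * cmod (fst z) \<le> e * 1" using e z by (intro mult_left_mono) auto
        then show "cmod (e *\<^sub>R (cnj (fst \<tau>) * fst z)) \<le> e * 1"
          using e \<tau> by (simp add: norm_mult)
      qed
      finally have "cmod (1 - cnj (fst w) * fst z) \<le> 2 * e" by simp
      then have "m * (cmod (1 - cnj (fst w) * fst z))\<^sup>2 \<le> 1 / (4 * c) * (2 * e)\<^sup>2"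
        using m c by (intro mult_mono power_mono) auto
      also have "\<dots> = e / c * e"
        using c by (simp add: power2_eq_square)
      also have "\<dots> \<le> (1 - (cmod (fst z))\<^sup>2) * (1 - (cmod (fst w))\<^sup>2)"
      proof (rule mult_mono)
        have "(cmod (fst z))\<^sup>2 \<le> cmod (fst z)"
          using z by (simp add: power2_eq_square mult_left_le)
        then show "e / c \<le> 1 - (cmod (fst z))\<^sup>2" using ec by linarith
        have "0 \<le> e * (1 - e)" using e by simp
        then show "e \<le> 1 - (cmod (fst w))\<^sup>2"
          unfolding w1 by (simp add: power2_eq_square algebra_simps)
      qed (use e z in \<open>auto simp: power_le_one\<close>)
      finally have h1: "m * (cmod (1 - cnj (fst w) * fst z))\<^sup>2
          \<le> (1 - (cmod (fst z))\<^sup>2) * (1 - (cmod (fst w))\<^sup>2)" .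
      have "cmod (1 - cnj (snd w) * snd z) \<le> cmod 1 + cmod (cnj (snd w) * snd z)"
        by (rule norm_triangle_ineq4)
      also have "\<dots> \<le> 1 + 1 * 1"
        unfolding norm_mult using wB z by (intro add_mono mult_mono) (auto simp: mem_bidisk)
      finally have "cmod (1 - cnj (snd w) * snd z) \<le> 2" by simp
      then have "m * (cmod (1 - cnj (snd w) * snd z))\<^sup>2 \<le> m * 2\<^sup>2"
        using m by (intro mult_mono power_mono) auto
      also have "\<dots> \<le> (1 - s\<^sup>2) * (1 - s\<^sup>2)"
        using m by (simp add: power2_eq_square)
      also have "\<dots> \<le> (1 - (cmod (snd z))\<^sup>2) * (1 - (cmod (snd w))\<^sup>2)"
        using s2 elim w2 z by (intro mult_mono diff_left_mono power_mono) (auto simp: power_le_one)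
      finally have h2: "m * (cmod (1 - cnj (snd w) * snd z))\<^sup>2
          \<le> (1 - (cmod (snd z))\<^sup>2) * (1 - (cmod (snd w))\<^sup>2)" .
      have "cmod (F z) \<le> (1 + k) / (1 - k) * cmod (F w)"
        using m1 pseudohyperbolic_le[OF h1] pseudohyperbolic_le[OF h2]
        by (intro harnack_bidisk[OF F pos zB wB k]) (simp_all add: k_def)
      then have "e * cmod (F z) \<le> e * ((1 + k) / (1 - k) * cmod (F w))"
        using e by (intro mult_left_mono) auto
      then show ?case
        using e by (simp add: norm_mult e_def t_def w_def mult_ac)
    qed
    have "((\<lambda>z. of_real (t z) * F ((1 - t z) *\<^sub>R \<tau>)) \<longlongrightarrow> 0) (at \<sigma> within S)"
      by (rule filterlim_compose[OF lim tlim])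
    then show "((\<lambda>z. (1 + k) / (1 - k) * cmod (of_real (t z) * F ((1 - t z) *\<^sub>R \<tau>))) \<longlongrightarrow> 0) (at \<sigma> within S)"
      by (intro tendsto_mult_right_zero tendsto_norm_zero)
  qed
qed

text \<open>In a Stolz angle one factor \<open>|t - fst z|\<close> is absorbed by \<open>1 - |fst z|\<^sup>2\<close>, and the other
  one tends to \<open>0\<close>.\<close>

lemma nt_limit_from_julia:
  assumes J: "julia_bound \<phi> (fst \<sigma>) \<omega> \<alpha>"
    and \<alpha>: "0 \<le> \<alpha>"
  shows "has_nt_limit \<phi> \<sigma> \<omega>"
  unfolding has_nt_limit_def
proof (intro allI impI)
  fix S assume S: "approaches_nt bidisk S \<sigma>"
  obtain c where c: "1 \<le> c" "\<And>z. z \<in> S \<Longrightarrow> cmod (fst \<sigma> - fst z) \<le> c * (1 - cmod (fst z))"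
    using approaches_nt_fst[OF S] by metis
  have SB: "S \<subseteq> bidisk" using S by (simp add: approaches_nt_def)
  have in_S: "\<forall>\<^sub>F z in at \<sigma> within S. z \<in> S"
    by (simp add: eventually_at_filter)
  show "(\<phi> \<longlongrightarrow> \<omega>) (at \<sigma> within S)"
  proof (rule Lim_null[THEN iffD2], rule Lim_null_comparison)
    show "\<forall>\<^sub>F z in at \<sigma> within S. cmod (\<phi> z - \<omega>) \<le> sqrt (\<alpha> * c * cmod (fst \<sigma> - fst z))"
      using in_S
    proof eventually_elim
      case (elim z)
      have zB: "z \<in> bidisk" using elim SB by auto
      define q where "q = 1 - (cmod (fst z))\<^sup>2"
      define t where "t = cmod (fst \<sigma> - fst z)"
      have z: "cmod (fst z) < 1" using zB by (simp add: mem_bidisk)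
      have q: "0 < q" using z by (simp add: q_def power_less_one_iff)
      have "(cmod (fst z))\<^sup>2 \<le> cmod (fst z)"
        using z by (simp add: power2_eq_square mult_left_le)
      then have "1 - cmod (fst z) \<le> q" by (simp add: q_def)
      then have "c * (1 - cmod (fst z)) \<le> c * q"
        using c by (intro mult_left_mono) auto
      then have tq: "t \<le> c * q"
        using c(2)[OF elim] by (simp add: t_def)
      have "(cmod (\<omega> - \<phi> z))\<^sup>2 * q \<le> \<alpha> * t\<^sup>2 * (1 - (cmod (\<phi> z))\<^sup>2)"
        using J zB by (simp add: julia_bound_def q_def t_def)
      also have "\<dots> \<le> \<alpha> * t\<^sup>2 * 1"
        using \<alpha> by (intro mult_left_mono) auto
      also have "\<dots> = \<alpha> * t * t" by (simp add: power2_eq_square)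
      also have "\<dots> \<le> \<alpha> * t * (c * q)"
        using \<alpha> tq by (intro mult_left_mono) (auto simp: t_def)
      finally have "(cmod (\<omega> - \<phi> z))\<^sup>2 * q \<le> (\<alpha> * c * t) * q"
        by (simp add: mult_ac)
      then have "(cmod (\<omega> - \<phi> z))\<^sup>2 \<le> \<alpha> * c * t"
        using q by simp
      then show ?case
        by (intro real_le_rsqrt) (simp add: t_def norm_minus_commute)
    qed
    show "((\<lambda>z. sqrt (\<alpha> * c * cmod (fst \<sigma> - fst z))) \<longlongrightarrow> 0) (at \<sigma> within S)"
      by (auto intro!: tendsto_eq_intros)
  qed
qed

section \<open>The first-order expansion\<close>

text \<open>If \<open>\<phi> z\<close> is unimodular then \<open>|1 - cnj (\<phi> z) \<phi> w| = |\<phi> z - \<phi> w|\<close>, and Schwarz--Pick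
  with a factor less than one leaves no room for a difference.\<close>

lemma unimodular_value_imp_constant:
  assumes f: "disc_holomorphic \<phi>" and b: "\<And>z. z \<in> bidisk \<Longrightarrow> cmod (\<phi> z) \<le> 1"
    and z: "z \<in> bidisk" and w: "w \<in> bidisk" and 1: "cmod (\<phi> z) = 1"
  shows "\<phi> w = \<phi> z"
proof -
  have "\<exists>k. cmod (i w - i z) \<le> k * cmod (1 - cnj (i z) * i w) \<and> k < 1"
    if "cmod (i w) < 1" "cmod (i z) < 1" for i :: "complex \<times> complex \<Rightarrow> complex"
  proof -
    have "cmod (i w - i z) < cmod (1 - cnj (i z) * i w)"
      using pseudohyperbolic_lt_1 that by blast
    then show ?thesis
      by (intro exI[of _ "cmod (i w - i z) / cmod (1 - cnj (i z) * i w)"])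
         (auto simp: divide_simps)
  qed
  from this[of fst] this[of snd] obtain k l
    where k: "cmod (fst w - fst z) \<le> k * cmod (1 - cnj (fst z) * fst w)" "k < 1"
      and l: "cmod (snd w - snd z) \<le> l * cmod (1 - cnj (snd z) * snd w)" "l < 1"
    using z w by (auto simp: mem_bidisk)
  define q where "q = max (1/2) (max k l)"
  have q: "0 < q" "q < 1" "k \<le> q" "l \<le> q"
    using k l by (auto simp: q_def)
  have "cmod (\<phi> w - \<phi> z) \<le> q * cmod (1 - cnj (\<phi> z) * \<phi> w)"
    using q(1,2)
    by (intro schwarz_pick_bidisk[OF f b w z] order_trans[OF k(1)] order_trans[OF l(1)]
        mult_right_mono q) auto
  also have "\<dots> = q * cmod (\<phi> w - \<phi> z)"
    using norm_one_minus_cnj_unit[OF 1] by (simp add: norm_minus_commute)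
  finally have "(1 - q) * cmod (\<phi> w - \<phi> z) \<le> 0"
    by (simp add: algebra_simps)
  then show ?thesis
    using q by (simp add: mult_le_0_iff)
qed

lemma Re_cayley:
  assumes "cmod \<omega> = 1" "p \<noteq> \<omega>"
  shows "Re ((\<omega> + p) / (\<omega> - p)) = (1 - (cmod p)\<^sup>2) / (cmod (\<omega> - p))\<^sup>2"
proof -
  have "(\<omega> + p) / (\<omega> - p) = (\<omega> + p) * cnj (\<omega> - p) / of_real ((cmod (\<omega> - p))\<^sup>2)"
    by (rule complex_div_cnj)
  moreover have "Re ((\<omega> + p) * cnj (\<omega> - p)) = (cmod \<omega>)\<^sup>2 - (cmod p)\<^sup>2"
    unfolding cmod_power2 by (simp add: power2_eq_square algebra_simps)
  ultimately show ?thesis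
    using assms by (simp only: Re_divide_of_real) simp
qed

text \<open>The quotient of \<open>\<omega> - \<phi> z\<close> by \<open>fst \<tau> - fst z\<close> alone converges; the second
  coordinate does not enter, which is why the second component of the gradient is \<open>0\<close>. With
  \<open>P = (\<omega> + \<phi>) / (\<omega> - \<phi>)\<close> the quotient is \<open>2 \<omega> / (t (P + 1))\<close>, where \<open>t z = fst \<tau> - fst z\<close>,
  so it suffices to find the limit of \<open>t P\<close>.\<close>

lemma expands_along_from_julia:
  assumes f: "disc_holomorphic \<phi>" and b: "\<And>z. z \<in> bidisk \<Longrightarrow> cmod (\<phi> z) \<le> 1"
    and J: "julia_bound \<phi> (fst \<tau>) \<omega> \<alpha>" and \<omega>: "cmod \<omega> = 1"
    and \<alpha>: "0 \<le> \<alpha>" "julia_liminf \<phi> \<tau> = ereal \<alpha>"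
    and \<tau>: "cmod (fst \<tau>) = 1" "cmod (snd \<tau>) < 1"
    and \<sigma>: "fst \<sigma> = fst \<tau>" "cmod (snd \<sigma>) < 1" and S: "approaches_nt bidisk S \<sigma>"
  shows "expands_along \<phi> \<sigma> S \<omega> (\<omega> * cnj (fst \<tau>) * of_real \<alpha>, 0)"
proof -
  define t where "t z = fst \<tau> - fst z" for z :: "complex \<times> complex"
  define L where "L = \<omega> * cnj (fst \<tau>) * of_real \<alpha>"
  have SB: "S \<subseteq> bidisk" using S by (simp add: approaches_nt_def)
  have in_S: "\<forall>\<^sub>F z in at \<sigma> within S. z \<in> S"
    by (simp add: eventually_at_filter)
  have t: "t z \<noteq> 0" if "z \<in> bidisk" for z
    using that \<tau> by (auto simp: t_def mem_bidisk)
  have \<tau>0: "fst \<tau> \<noteq> 0" using \<tau> by auto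
  have \<tau>cnj: "cnj (fst \<tau>) = inverse (fst \<tau>)"
    using \<tau> complex_norm_square[of "fst \<tau>"] \<tau>0 by (simp add: field_simps)
  have quot: "((\<lambda>z. (\<omega> - \<phi> z) / t z) \<longlongrightarrow> L) (at \<sigma> within S)"
  proof (cases "\<exists>z\<in>bidisk. \<phi> z = \<omega>")
    case True
    then have const: "\<phi> z = \<omega>" if "z \<in> bidisk" for z
      using unimodular_value_imp_constant[OF f b _ that] \<omega> by metis
    \<comment> \<open>A constant of modulus one has all its Julia quotients equal to zero.\<close>
    have "\<alpha> = 0"
    proof (rule ccontr)
      assume "\<alpha> \<noteq> 0"
      then have "ereal 0 < julia_liminf \<phi> \<tau>" using \<alpha> by simp
      from less_julia_liminfD[OF this] \<tau>
      have "\<forall>\<^sub>F e in at_right 0. 0 < (1 - cmod (\<phi> ((1 - e) *\<^sub>R \<tau>))) / e" by simp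
      with eventually_at_right_real[OF zero_less_one]
      have "\<forall>\<^sub>F e in at_right (0::real). False"
      proof eventually_elim
        case (elim e)
        then have "\<phi> ((1 - e) *\<^sub>R \<tau>) = \<omega>"
          using \<tau> by (intro const ray_toward_origin(3)) auto
        with elim \<omega> show False by simp
      qed
      then show False by simp
    qed
    then have "L = 0" by (simp add: L_def)
    moreover have "((\<lambda>z. (\<omega> - \<phi> z) / t z) \<longlongrightarrow> 0) (at \<sigma> within S)"
      by (rule tendsto_eventually) (use in_S SB const in \<open>auto elim!: eventually_mono\<close>)
    ultimately show ?thesis by simp
  next
    case False
    then have ne: "\<phi> z \<noteq> \<omega>" if "z \<in> bidisk" for z using that by blast
    \<comment> \<open>For \<open>\<alpha> = 0\<close> Julia's inequality would make \<open>\<phi>\<close> attain \<open>\<omega>\<close>.\<close>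
    have \<alpha>0: "0 < \<alpha>"
    proof (rule ccontr)
      assume "\<not> 0 < \<alpha>"
      with \<alpha> have "\<alpha> = 0" by simp
      moreover have "0 \<in> bidisk" by (simp add: mem_bidisk)
      ultimately have "(cmod (\<omega> - \<phi> 0))\<^sup>2 \<le> 0"
        using J unfolding julia_bound_def by fastforce
      with ne[OF \<open>0 \<in> bidisk\<close>] show False by simp
    qed
    define P where "P z = (\<omega> + \<phi> z) / (\<omega> - \<phi> z)" for z
    define F where "F z = P z - (fst \<tau> + fst z) / (\<alpha> * t z)" for z
    have "disc_holomorphic F"
      unfolding disc_holomorphic_def
    proof (intro allI impI, elim conjE)
      fix u v :: "complex \<Rightarrow> complex"
      assume u: "u holomorphic_on ball 0 1" and v: "v holomorphic_on ball 0 1"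
        and uv: "\<forall>\<zeta>\<in>ball 0 1. (u \<zeta>, v \<zeta>) \<in> bidisk"
      have "(\<lambda>\<zeta>. \<phi> (u \<zeta>, v \<zeta>)) holomorphic_on ball 0 1"
        using f u v uv by (simp add: disc_holomorphic_def)
      moreover have "\<omega> - \<phi> (u \<zeta>, v \<zeta>) \<noteq> 0" "fst \<tau> - u \<zeta> \<noteq> 0" if "\<zeta> \<in> ball 0 1" for \<zeta>
        using ne[of "(u \<zeta>, v \<zeta>)"] t[of "(u \<zeta>, v \<zeta>)"] uv that by (auto simp: t_def)
      ultimately show "(\<lambda>\<zeta>. F (u \<zeta>, v \<zeta>)) holomorphic_on ball 0 1"
        unfolding F_def P_def t_def fst_conv using \<alpha>0 u
        by (intro holomorphic_intros) auto
    qed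
    moreover have "0 \<le> Re (F z)" if z: "z \<in> bidisk" for z
    proof -
      define N M where "N = (cmod (\<omega> - \<phi> z))\<^sup>2" and "M = (cmod (t z))\<^sup>2"
      have NM: "0 < N" "0 < M" using ne[OF z] t[OF z] by (auto simp: N_def M_def)
      have "fst z \<noteq> fst \<tau>" using t[OF z] by (auto simp: t_def)
      have "(fst \<tau> + fst z) / (\<alpha> * t z) = (fst \<tau> + fst z) / (fst \<tau> - fst z) / of_real \<alpha>"
        by (simp add: t_def field_simps)
      then have "Re (F z) = (1 - (cmod (\<phi> z))\<^sup>2) / N - (1 - (cmod (fst z))\<^sup>2) / M / \<alpha>"
        unfolding F_def P_def minus_complex.sel
        using Re_cayley[OF \<omega> ne[OF z]] Re_cayley[OF \<tau>(1) \<open>fst z \<noteq> fst \<tau>\<close>]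
        by (simp only: Re_divide_of_real N_def M_def t_def)
      moreover have "N * (1 - (cmod (fst z))\<^sup>2) \<le> \<alpha> * M * (1 - (cmod (\<phi> z))\<^sup>2)"
        using J z by (simp add: julia_bound_def N_def M_def t_def)
      then have "(1 - (cmod (fst z))\<^sup>2) / M / \<alpha> \<le> (1 - (cmod (\<phi> z))\<^sup>2) / N"
        using NM \<alpha>0 by (simp add: field_simps)
      ultimately show ?thesis by linarith
    qed
    moreover have "((\<lambda>e. of_real e * F ((1 - e) *\<^sub>R \<tau>)) \<longlongrightarrow> 0) (at_right 0)"
    proof -
      define y where "y e = (\<omega> - \<phi> ((1 - e) *\<^sub>R \<tau>)) / of_real e" for e :: real
      have y: "(y \<longlongrightarrow> \<omega> * of_real \<alpha>) (at_right 0)"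
        unfolding y_def using radial_derivative[OF J b \<omega> \<alpha>] \<tau> by simp
      have "((\<lambda>e. (2 * \<omega> - of_real e * y e) / y e - of_real ((2 - e) / \<alpha>))
              \<longlongrightarrow> (2 * \<omega> - of_real 0 * (\<omega> * of_real \<alpha>)) / (\<omega> * of_real \<alpha>) - of_real ((2 - 0) / \<alpha>)) (at_right 0)"
        using \<omega> \<alpha>0 by (intro tendsto_intros y) auto
      also have "(2 * \<omega> - of_real 0 * (\<omega> * of_real \<alpha>)) / (\<omega> * of_real \<alpha>) - of_real ((2 - 0) / \<alpha>) = 0"
        using \<omega> \<alpha>0 by (auto simp: field_simps)
      finally have "((\<lambda>e. (2 * \<omega> - of_real e * y e) / y e - of_real ((2 - e) / \<alpha>)) \<longlongrightarrow> 0) (at_right 0)" .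
      moreover have "\<forall>\<^sub>F e in at_right 0. (2 * \<omega> - of_real e * y e) / y e - of_real ((2 - e) / \<alpha>)
          = of_real e * F ((1 - e) *\<^sub>R \<tau>)"
        using eventually_at_right_real[OF zero_less_one]
      proof eventually_elim
        case (elim e)
        then have e: "0 < e" "e < 1" by auto
        define p where "p = \<phi> ((1 - e) *\<^sub>R \<tau>)"
        have 1: "(2 * \<omega> - of_real e * y e) / y e = of_real e * P ((1 - e) *\<^sub>R \<tau>)"
          proof -
            have "of_real e * y e = \<omega> - p"
              using e by (simp add: y_def p_def)
            then have "2 * \<omega> - of_real e * y e = \<omega> + p"
              by (simp only:) simp
            then show ?thesis
              unfolding y_def P_def p_def[symmetric] by simp
          qed
        \<comment> \<open>On the radius the Cayley kernel is real: \<open>(t + z\<^sup>1) / (t - z\<^sup>1) = (2 - e) / e\<close>.\<close>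
        have num: "fst \<tau> + fst ((1 - e) *\<^sub>R \<tau>) = of_real (2 - e) * fst \<tau>"
          and den: "t ((1 - e) *\<^sub>R \<tau>) = of_real e * fst \<tau>"
          by (simp_all add: t_def scaleR_conv_of_real algebra_simps)
        have 2: "of_real e * ((fst \<tau> + fst ((1 - e) *\<^sub>R \<tau>)) / (\<alpha> * t ((1 - e) *\<^sub>R \<tau>)))
             = of_real ((2 - e) / \<alpha>)"
          unfolding num den using e \<alpha>0 \<tau>0 by (simp add: field_simps)
        show ?case
          unfolding F_def right_diff_distrib 1 2 ..
      qed
      ultimately show ?thesis
        by (rule Lim_transform_eventually)
    qed
    ultimately have tF: "((\<lambda>z. t z * F z) \<longlongrightarrow> 0) (at \<sigma> within S)"
      unfolding t_def using \<tau> \<sigma> S by (intro harnack_nontangential) auto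
    have "((\<lambda>z. 2 * \<omega> / (t z * F z + (fst \<tau> + fst z) / \<alpha> + t z))
        \<longlongrightarrow> 2 * \<omega> / (0 + (fst \<tau> + fst \<sigma>) / \<alpha> + t \<sigma>)) (at \<sigma> within S)"
      unfolding t_def using \<alpha>0 \<tau>0 \<sigma> by (intro tendsto_intros tF[unfolded t_def]) (auto simp: t_def)
    also have "2 * \<omega> / (0 + (fst \<tau> + fst \<sigma>) / \<alpha> + t \<sigma>) = L"
      using \<alpha>0 \<tau>0 \<sigma> by (simp add: L_def t_def \<tau>cnj field_simps)
    finally have "((\<lambda>z. 2 * \<omega> / (t z * F z + (fst \<tau> + fst z) / \<alpha> + t z)) \<longlongrightarrow> L) (at \<sigma> within S)" .
    moreover have "\<forall>\<^sub>F z in at \<sigma> within S.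
        2 * \<omega> / (t z * F z + (fst \<tau> + fst z) / \<alpha> + t z) = (\<omega> - \<phi> z) / t z"
      using in_S
    proof eventually_elim
      case (elim z)
      then have z: "z \<in> bidisk" using SB by auto
      have "t z * F z + (fst \<tau> + fst z) / \<alpha> + t z = t z * (P z + 1)"
        using t[OF z] \<alpha>0 by (simp add: F_def field_simps)
      also have "P z + 1 = 2 * \<omega> / (\<omega> - \<phi> z)"
        using ne[OF z] by (simp add: P_def field_simps)
      finally have den: "t z * F z + (fst \<tau> + fst z) / \<alpha> + t z = t z * (2 * \<omega> / (\<omega> - \<phi> z))" .
      have "\<omega> \<noteq> 0" using \<omega> by auto
      then show ?case
        unfolding den by simp
    qed
    ultimately show ?thesis
      by (rule Lim_transform_eventually)
  qed
  show ?thesis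
    unfolding expands_along_def
  proof (rule Lim_null_comparison)
    show "\<forall>\<^sub>F z in at \<sigma> within S. cmod ((\<phi> z - (\<omega> + fst (\<omega> * cnj (fst \<tau>) * of_real \<alpha>, 0::complex) * (fst z - fst \<sigma>)
        + snd (\<omega> * cnj (fst \<tau>) * of_real \<alpha>, 0) * (snd z - snd \<sigma>))) / complex_of_real (maxnorm (z - \<sigma>)))
        \<le> cmod ((\<omega> - \<phi> z) / t z - L)"
      using in_S
    proof eventually_elim
      case (elim z)
      then have tz: "t z \<noteq> 0" using SB t by blast
      have tm: "cmod (t z) \<le> maxnorm (z - \<sigma>)"
        by (simp add: t_def maxnorm_def \<sigma> norm_minus_commute)
      have m: "0 < maxnorm (z - \<sigma>)"
        using tm tz by (meson less_le_trans zero_less_norm_iff)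
      have "\<phi> z - (\<omega> + L * (fst z - fst \<sigma>) + 0 * (snd z - snd \<sigma>)) = - (t z * ((\<omega> - \<phi> z) / t z - L))"
        using tz by (simp add: t_def \<sigma> field_simps)
      then have "cmod (\<phi> z - (\<omega> + L * (fst z - fst \<sigma>) + 0 * (snd z - snd \<sigma>)))
          = cmod (t z) * cmod ((\<omega> - \<phi> z) / t z - L)"
        by (simp only: norm_minus_cancel norm_mult)
      also have "\<dots> \<le> maxnorm (z - \<sigma>) * cmod ((\<omega> - \<phi> z) / t z - L)"
        using tm by (intro mult_right_mono) auto
      finally show ?case
        using m unfolding L_def[symmetric] fst_conv snd_conv norm_divide
        by (simp add: divide_simps mult.commute)
    qed
    show "((\<lambda>z. cmod ((\<omega> - \<phi> z) / t z - L)) \<longlongrightarrow> 0) (at \<sigma> within S)"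
      using quot by (intro tendsto_norm_zero) (simp add: Lim_null[symmetric])
  qed
qed

section \<open>Uniqueness of limits and gradients\<close>

lemma nt_value_eqI:
  assumes \<sigma>: "cmod (fst \<sigma>) = 1" "cmod (snd \<sigma>) \<le> 1" and "has_nt_limit \<phi> \<sigma> L"
  shows "nt_value \<phi> \<sigma> = L"
  unfolding nt_value_def
proof (rule the_equality)
  fix K assume K: "has_nt_limit \<phi> \<sigma> K"
  have *: "maxnorm (\<sigma> + e *\<^sub>R (- \<sigma>)) \<le> 1 - e" if "0 < e" "e < 1" for e
    using ray_toward_origin(2)[OF \<sigma> that] by (simp add: scaleR_left_diff_distrib)
  have v: "maxnorm (- \<sigma>) = 1" using ray_toward_origin(1)[OF \<sigma>] by (simp add: maxnorm_def)
  note S = approaches_nt_ray[OF ray_toward_origin(1)[OF \<sigma>] v zero_less_one *]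
  have "((\<lambda>e. \<phi> (\<sigma> + e *\<^sub>R (- \<sigma>))) \<longlongrightarrow> M) (at_right 0)" if "has_nt_limit \<phi> \<sigma> M" for M
    using that S(1) by (intro filterlim_compose[OF _ S(2)]) (auto simp: has_nt_limit_def)
  from this[OF K] this[OF assms(3)] show "K = L"
    by (intro tendsto_unique[of "at_right (0::real)"]) auto
qed fact

text \<open>Division by the maximum norm becomes division by \<open>e\<close> on a ray with a direction \<open>v\<close> of norm
  one, so an expansion yields the derivative in the direction \<open>v\<close>.\<close>

lemma expands_along_ray:
  assumes "expands_along \<phi> \<sigma> S \<omega> \<eta>"
    and v: "maxnorm v = 1" and ray: "filterlim (\<lambda>e. \<sigma> + e *\<^sub>R v) (at \<sigma> within S) (at_right 0)"
  shows "((\<lambda>e. (\<phi> (\<sigma> + e *\<^sub>R v) - \<omega>) / of_real e) \<longlongrightarrow> fst \<eta> * fst v + snd \<eta> * snd v) (at_right 0)"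
proof -
  have "((\<lambda>e. (\<phi> (\<sigma> + e *\<^sub>R v) - (\<omega> + fst \<eta> * (fst (\<sigma> + e *\<^sub>R v) - fst \<sigma>) + snd \<eta> * (snd (\<sigma> + e *\<^sub>R v) - snd \<sigma>)))
            / complex_of_real (maxnorm (\<sigma> + e *\<^sub>R v - \<sigma>))) \<longlongrightarrow> 0) (at_right 0)"
    using filterlim_compose[OF assms(1)[unfolded expands_along_def] ray] .
  moreover have "\<forall>\<^sub>F e in at_right 0. (\<phi> (\<sigma> + e *\<^sub>R v) - (\<omega> + fst \<eta> * (fst (\<sigma> + e *\<^sub>R v) - fst \<sigma>) + snd \<eta> * (snd (\<sigma> + e *\<^sub>R v) - snd \<sigma>)))
            / complex_of_real (maxnorm (\<sigma> + e *\<^sub>R v - \<sigma>))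
       = (\<phi> (\<sigma> + e *\<^sub>R v) - \<omega>) / of_real e - (fst \<eta> * fst v + snd \<eta> * snd v)"
    using eventually_at_right_less[of 0]
  proof eventually_elim
    case (elim e)
    have "maxnorm (e *\<^sub>R v) = e * maxnorm v"
      using elim by (simp add: maxnorm_def max_mult_distrib_left)
    with v have "maxnorm (\<sigma> + e *\<^sub>R v - \<sigma>) = e" by simp
    then show ?case
      using elim by (simp add: scaleR_conv_of_real divide_simps) (simp add: algebra_simps)
  qed
  ultimately have "((\<lambda>e. (\<phi> (\<sigma> + e *\<^sub>R v) - \<omega>) / of_real e - (fst \<eta> * fst v + snd \<eta> * snd v)) \<longlongrightarrow> 0) (at_right 0)"
    by (rule Lim_transform_eventually)
  then show ?thesis
    by (simp add: Lim_null[symmetric])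
qed

text \<open>Two competing expansions are compared on the rays with directions \<open>(- fst \<sigma>, s)\<close>. The
  choices \<open>s = 0\<close> and \<open>s = 1\<close> separate the two components.\<close>

lemma angular_gradient_eqI:
  assumes \<sigma>: "cmod (fst \<sigma>) = 1" "cmod (snd \<sigma>) < 1" and \<eta>: "has_angular_gradient \<phi> \<sigma> \<eta>"
  shows "angular_gradient \<phi> \<sigma> = \<eta>"
  unfolding angular_gradient_def
proof (rule the_equality)
  fix \<theta> assume \<theta>: "has_angular_gradient \<phi> \<sigma> \<theta>"
  obtain a where a: "\<And>S. approaches_nt bidisk S \<sigma> \<Longrightarrow> expands_along \<phi> \<sigma> S a \<eta>"
    using \<eta> by (auto simp: has_angular_gradient_def)
  obtain b where b: "\<And>S. approaches_nt bidisk S \<sigma> \<Longrightarrow> expands_along \<phi> \<sigma> S b \<theta>"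
    using \<theta> by (auto simp: has_angular_gradient_def)
  \<comment> \<open>Both gradients have the same derivative in each of these directions.\<close>
  have dir: "fst \<theta> * (- fst \<sigma>) + snd \<theta> * s = fst \<eta> * (- fst \<sigma>) + snd \<eta> * s"
    if s: "cmod s \<le> 1" for s
  proof -
    define v where "v = (- fst \<sigma>, s)"
    \<comment> \<open>Short enough for the second coordinate to stay at least as far from the circle as the first.\<close>
    define e0 where "e0 = (1 - cmod (snd \<sigma>)) / 2"
    have v: "maxnorm v = 1" using s \<sigma> by (simp add: v_def maxnorm_def)
    have "maxnorm \<sigma> = 1" using \<sigma> by (simp add: maxnorm_def)
    moreover have e0: "0 < e0" "e0 < 1" using \<sigma>(2) by (simp_all add: e0_def less_le_trans[OF _ norm_ge_zero])
    moreover have "maxnorm (\<sigma> + e *\<^sub>R v) \<le> 1 - e" if e: "0 < e" "e < e0" for e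
    proof -
      have "fst (\<sigma> + e *\<^sub>R v) = (1 - e) *\<^sub>R fst \<sigma>"
        by (simp add: v_def scaleR_left_diff_distrib)
      then have "cmod (fst (\<sigma> + e *\<^sub>R v)) = 1 - e"
        using \<sigma> e e0 by simp
      moreover have "cmod (snd (\<sigma> + e *\<^sub>R v)) \<le> cmod (snd \<sigma>) + e * cmod s"
        using norm_triangle_ineq[of "snd \<sigma>" "e *\<^sub>R s"] e by (simp add: v_def)
      moreover have "e * cmod s \<le> e * 1" using s e by (intro mult_left_mono) auto
      moreover have "cmod (snd \<sigma>) + e \<le> 1 - e" using e by (simp add: e0_def)
      ultimately show ?thesis
        unfolding maxnorm_def by linarith
    qed
    ultimately have S: "approaches_nt bidisk ((\<lambda>e. \<sigma> + e *\<^sub>R v) ` {0<..<e0}) \<sigma>"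
      "filterlim (\<lambda>e. \<sigma> + e *\<^sub>R v) (at \<sigma> within (\<lambda>e. \<sigma> + e *\<^sub>R v) ` {0<..<e0}) (at_right 0)"
      using approaches_nt_ray v by blast+
    define A where "A e = (\<phi> (\<sigma> + e *\<^sub>R v) - a) / of_real e" for e :: real
    define B where "B e = (\<phi> (\<sigma> + e *\<^sub>R v) - b) / of_real e" for e :: real
    have A: "(A \<longlongrightarrow> fst \<eta> * fst v + snd \<eta> * snd v) (at_right 0)"
      unfolding A_def by (rule expands_along_ray[OF a[OF S(1)] v S(2)])
    have B: "(B \<longlongrightarrow> fst \<theta> * fst v + snd \<theta> * snd v) (at_right 0)"
      unfolding B_def by (rule expands_along_ray[OF b[OF S(1)] v S(2)])
    \<comment> \<open>The constant terms agree first: their difference is \<open>e\<close> times a bounded quantity.\<close>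
    have "((\<lambda>e. of_real e * (A e - B e)) \<longlongrightarrow>
        of_real 0 * (fst \<eta> * fst v + snd \<eta> * snd v - (fst \<theta> * fst v + snd \<theta> * snd v))) (at_right 0)"
      by (intro tendsto_intros A B)
    moreover have "\<forall>\<^sub>F e in at_right 0. of_real e * (A e - B e) = b - a"
      using eventually_at_right_less[of 0]
      by eventually_elim (simp add: A_def B_def field_simps)
    ultimately have "((\<lambda>e::real. b - a) \<longlongrightarrow>
        of_real 0 * (fst \<eta> * fst v + snd \<eta> * snd v - (fst \<theta> * fst v + snd \<theta> * snd v))) (at_right 0)"
      by (rule Lim_transform_eventually)
    then have "b - a = of_real 0 * (fst \<eta> * fst v + snd \<eta> * snd v - (fst \<theta> * fst v + snd \<theta> * snd v))"
      by (rule tendsto_unique[OF trivial_limit_at_right_real tendsto_const])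
    then have "B = A" by (simp add: A_def B_def fun_eq_iff)
    then have "fst \<theta> * fst v + snd \<theta> * snd v = fst \<eta> * fst v + snd \<eta> * snd v"
      using A B by (intro tendsto_unique[of "at_right (0::real)"]) auto
    then show ?thesis by (simp add: v_def)
  qed
  have "fst \<sigma> \<noteq> 0" using \<sigma> by auto
  with dir[of 0] have "fst \<theta> = fst \<eta>" by simp
  with dir[of 1] show "\<theta> = \<eta>" by (simp add: prod_eq_iff)
qed fact

theorem theorem3p2:
  fixes \<phi> :: "complex \<times> complex \<Rightarrow> complex" and \<tau> :: "complex \<times> complex"
  assumes "\<phi> \<in> schur2"
    and "\<tau> \<in> sphere 0 1 \<times> ball 0 1"
    and "B_point \<phi> \<tau>"
  shows "(\<forall>\<sigma> \<in> {fst \<tau>} \<times> cball 0 1. B_point \<phi> \<sigma>) \<and>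
    (\<forall>\<sigma> \<in> {fst \<tau>} \<times> ball 0 1. C_point \<phi> \<sigma>) \<and>
    (\<forall>\<sigma> \<in> {fst \<tau>} \<times> cball 0 1.
       has_nt_limit \<phi> \<sigma> (nt_value \<phi> \<sigma>) \<and> nt_value \<phi> \<sigma> = nt_value \<phi> \<tau>) \<and>
    (\<forall>\<sigma> \<in> {fst \<tau>} \<times> ball 0 1.
       has_angular_gradient \<phi> \<sigma> (angular_gradient \<phi> \<sigma>) \<and>
       angular_gradient \<phi> \<sigma> =
         (nt_value \<phi> \<tau> * cnj (fst \<tau>) * complex_of_real (real_of_ereal (julia_liminf \<phi> \<tau>)), 0))"
proof -
  have f: "disc_holomorphic \<phi>" and b: "\<And>z. z \<in> bidisk \<Longrightarrow> cmod (\<phi> z) \<le> 1"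
    using assms(1) by (auto simp: schur2_def intro: disc_holomorphicI)
  have \<tau>: "cmod (fst \<tau>) = 1" "cmod (snd \<tau>) < 1"
    using assms(2) by auto
  obtain \<alpha> where \<alpha>: "julia_liminf \<phi> \<tau> = ereal \<alpha>" "0 \<le> \<alpha>"
    using julia_liminf_nonneg[of \<phi> \<tau>, OF b] assms(3)
    by (cases "julia_liminf \<phi> \<tau>") (auto simp: B_point_def)
  obtain \<omega> where \<omega>: "cmod \<omega> = 1" and J: "julia_bound \<phi> (fst \<tau>) \<omega> \<alpha>"
    using julia_inequality[OF f b \<tau> \<alpha>(1)] by blast
  have B: "B_point \<phi> \<sigma>" and lim: "has_nt_limit \<phi> \<sigma> \<omega>" and val: "nt_value \<phi> \<sigma> = \<omega>"
    if "fst \<sigma> = fst \<tau>" "cmod (snd \<sigma>) \<le> 1" for \<sigma>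
  proof -
    have J': "julia_bound \<phi> (fst \<sigma>) \<omega> \<alpha>" and \<sigma>: "cmod (fst \<sigma>) = 1"
      using J \<tau> that by simp_all
    show "B_point \<phi> \<sigma>"
      using B_pointI[OF J' b \<omega> \<alpha>(2) \<sigma> that(2)] .
    show "has_nt_limit \<phi> \<sigma> \<omega>"
      using nt_limit_from_julia[OF J' \<alpha>(2)] .
    then show "nt_value \<phi> \<sigma> = \<omega>"
      by (rule nt_value_eqI[OF \<sigma> that(2)])
  qed
  have val\<tau>: "nt_value \<phi> \<tau> = \<omega>" using val[of \<tau>] \<tau> by simp
  define \<eta> where "\<eta> = (\<omega> * cnj (fst \<tau>) * of_real \<alpha>, 0::complex)"
  have ex: "expands_along \<phi> \<sigma> S \<omega> \<eta>"
    if "fst \<sigma> = fst \<tau>" "cmod (snd \<sigma>) < 1" "approaches_nt bidisk S \<sigma>" for \<sigma> S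
    unfolding \<eta>_def by (rule expands_along_from_julia[OF f b J \<omega> \<alpha>(2,1) \<tau> that])
  have C: "C_point \<phi> \<sigma>" and grad: "has_angular_gradient \<phi> \<sigma> \<eta>" and "angular_gradient \<phi> \<sigma> = \<eta>"
    if \<sigma>: "fst \<sigma> = fst \<tau>" "cmod (snd \<sigma>) < 1" for \<sigma>
  proof -
    show "C_point \<phi> \<sigma>"
      using ex[OF \<sigma>] B[of \<sigma>] \<sigma> \<omega> unfolding C_point_def B_point_def by (metis less_imp_le)
    show "has_angular_gradient \<phi> \<sigma> \<eta>"
      using ex[OF \<sigma>] \<omega> unfolding has_angular_gradient_def by blast
    then show "angular_gradient \<phi> \<sigma> = \<eta>"
      using \<sigma> \<tau> by (intro angular_gradient_eqI) auto
  qed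
  moreover have "real_of_ereal (julia_liminf \<phi> \<tau>) = \<alpha>" using \<alpha> by simp
  ultimately show ?thesis
    using B lim val val\<tau> unfolding \<eta>_def by (auto simp del: of_real_mult)
qed

end
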